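(* Let $d=1$, $E=\mathbb{R}\times\{-1,1\}$, $\mu(x,v)\propto\exp(-U(x))\cdot\tfrac12$ with $U\in\mathbf{C}^{2}(\mathbb{R})$, $\int[1+|U'(x)|]e^{-U(x)}{\rm d}x<\infty$ and $\int|U'|^{2}{\rm d}\pi<\infty$ where $\pi(x)\propto e^{-U(x)}$. Let $Qf(x,v)=f(x,-v)$. Consider two one-dimensional Zig-Zag processes with the same refreshment rate $\bar\lambda\geq0$ and flip intensities $\lambda_{1}(x,v)=(U'(x)v)_{+}$ and $\lambda_{2}(x,v)=\lambda_{1}(x,v)+\gamma(x,v)$, where $\gamma\in\mathbf{C}^{1}(E)$, $0\leq\gamma\leq c+C|U'|$ for some $c,C>0$, and $\gamma(x,v)=\gamma(x,-v)$. Then for any $f\in L^{2}(\mu)$ with $Qf=f$ and any $\lambda>0$, ${\rm var}_{\lambda}(f,L_{1})\leq{\rm var}_{\lambda}(f,L_{2})$.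
   Context: One-dimensional Zig-Zag process with flip intensity $\lambda_{j}$ and refreshment rate $\bar\lambda$: the position moves as $x+tv$; the velocity is flipped $v\mapsto-v$ at rate $\lambda_{j}(x+tv,v)$ and redrawn uniformly from $\{-1,1\}$ at rate $\bar\lambda$. Its transition semigroup $\{P_{t}^{(j)}\}$ leaves $\mu$ invariant and extends to a strongly continuous contraction semigroup on $L^{2}(\mu)$; $L_{j}$ denotes its generator and ${\rm var}_{\lambda}(f,L_{j})=2\langle f,\int_{0}^{\infty}e^{-\lambda t}P_{t}^{(j)}f\,{\rm d}t\rangle_{\mu}$. $\mathbf{C}^{1}(E)$: $f$ with $x\mapsto f(x,v)$ continuously differentiable for each $v$. *)

theory Defs
  imports "HOL-Probability.Probability"
begin

definition zz_E :: "(real \<times> real) set" where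
  "zz_E = UNIV \<times> {-1, 1}"

definition zz_M :: "(real \<times> real) measure" where
  "zz_M = lborel \<Otimes>\<^sub>M count_space {-1, 1}"

definition zz_mu :: "(real \<Rightarrow> real) \<Rightarrow> (real \<times> real) measure" where
  "zz_mu U = density zz_M
     (\<lambda>(x, v). ennreal (exp (- U x) / (2 * (\<integral>y. exp (- U y) \<partial>lborel))))"

definition zz_surv :: "(real \<times> real \<Rightarrow> real) \<Rightarrow> real \<times> real \<Rightarrow> real \<Rightarrow> real" where
  "zz_surv R z s = exp (- (LBINT u=0..s. R (fst z + u * snd z, snd z)))"

text \<open>K is the transition kernel (K t z = law of the state at time t started at z) of the
  one-dimensional Zig-Zag process with flip intensity lam and refreshment rate lbar:
  the position moves as x + t v, the velocity is flipped at rate lam(x + t v, v) and redrawn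
  uniformly from {-1,1} at rate lbar.  It is characterised as the (unique) measurable
  probability kernel satisfying the first-jump (backward) decomposition for every bounded
  Borel observable g.\<close>
definition zz_kernel ::
  "(real \<times> real \<Rightarrow> real) \<Rightarrow> real \<Rightarrow> (real \<Rightarrow> real \<times> real \<Rightarrow> (real \<times> real) measure) \<Rightarrow> bool" where
  "zz_kernel lam lbar K \<longleftrightarrow>
     (\<lambda>(t, z). K t z) \<in> measurable (restrict_space borel {0..} \<Otimes>\<^sub>M zz_M) (prob_algebra zz_M) \<and>
     (\<forall>g t z. g \<in> borel_measurable zz_M \<longrightarrow> bounded (range g) \<longrightarrow> 0 \<le> t \<longrightarrow> z \<in> zz_E \<longrightarrow>
        (\<integral>w. g w \<partial>K t z) =
          zz_surv (\<lambda>w. lam w + lbar) z t * g (fst z + t * snd z, snd z)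
          + (LBINT s=0..t. zz_surv (\<lambda>w. lam w + lbar) z s *
               (lam (fst z + s * snd z, snd z) *
                  (\<integral>w. g w \<partial>K (t - s) (fst z + s * snd z, - snd z))
                + lbar * ((1/2) * (\<integral>w. g w \<partial>K (t - s) (fst z + s * snd z, 1))
                        + (1/2) * (\<integral>w. g w \<partial>K (t - s) (fst z + s * snd z, -1))))))"

definition zz_semigroup ::
  "(real \<Rightarrow> real \<times> real \<Rightarrow> (real \<times> real) measure) \<Rightarrow> real \<Rightarrow> (real \<times> real \<Rightarrow> real) \<Rightarrow> real \<times> real \<Rightarrow> real" where
  "zz_semigroup K t f z = (\<integral>w. f w \<partial>K t z)"

definition zz_var ::
  "(real \<times> real) measure \<Rightarrow> (real \<Rightarrow> real \<times> real \<Rightarrow> (real \<times> real) measure) \<Rightarrow> real \<Rightarrow> (real \<times> real \<Rightarrow> real) \<Rightarrow> real" where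
  "zz_var mu K l f = 2 * (\<integral>z. f z * (LBINT t:{0..}. exp (- l * t) * zz_semigroup K t f z) \<partial>mu)"

definition zz_L2 :: "(real \<times> real) measure \<Rightarrow> (real \<times> real \<Rightarrow> real) \<Rightarrow> bool" where
  "zz_L2 mu f \<longleftrightarrow> f \<in> borel_measurable mu \<and> integrable mu (\<lambda>z. (f z)\<^sup>2)"

end

theory Submission
  imports Defs
begin

text \<open>
  Let \<open>u = \<integral>\<^sub>0\<^sup>\<infinity> e\<^sup>-\<^sup>l\<^sup>t P\<^sub>t f dt\<close> with \<open>f\<close> even in \<open>v\<close>, and split \<open>u(x, v) = a(x) + v b(x)\<close>.  Along the flow the
  first-jump equation becomes the linear system
  \<open>a' = \<kappa> b\<close>, \<open>b' = U' b + l a - f\<close> with \<open>\<kappa>(x) = l + lbar + lam(x, 1) + lam(x, -1)\<close>,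
  because \<open>lam(x, 1) - lam(x, -1) = U'(x)\<close>.  Integrating the derivative of \<open>e\<^sup>-\<^sup>U a\<^sub>i b\<^sub>j\<close> over the line gives
  \<open>\<langle>f, a\<^sub>i\<rangle> = l \<langle>a\<^sub>i, a\<^sub>j\<rangle> + \<langle>\<kappa>\<^sub>i b\<^sub>i, b\<^sub>j\<rangle>\<close> for the two processes \<open>i, j \<in> {1, 2}\<close>.  Since \<open>\<kappa>\<^sub>1 \<le> \<kappa>\<^sub>2\<close>, AM-GM applied to
  the mixed identity yields \<open>2 \<langle>f, a\<^sub>1\<rangle> \<le> \<langle>f, a\<^sub>1\<rangle> + \<langle>f, a\<^sub>2\<rangle>\<close>.  This is done for bounded continuous \<open>f\<close>, where
  everything is classical; the same integration with \<open>e\<^sup>-\<^sup>U b\<close> shows that the target is invariant, and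
  invariance makes the variance continuous under dominated convergence in \<open>L\<^sup>2\<close>.
\<close>

subsection \<open>Integrals along the flow\<close>

text \<open>The integrand is the derivative of \<open>- exp (- A y)\<close>, and
  \<open>k \<ge> l > 0\<close> makes \<open>A\<close> grow at least linearly, so this primitive
  tends to 0. As \<open>k\<close> may be unbounded, \<open>exp (- A y) * k y\<close> is the
  dominating function for everything of the size of the rate.\<close>

lemma exp_minus_antiderivative_integrable:
  fixes A k :: "real \<Rightarrow> real"
  assumes A: "\<And>y. (A has_real_derivative k y) (at y)"
    and k_cont: "continuous_on UNIV k" and k_ge: "\<And>y. l \<le> k y" and l: "0 < l"
  shows "set_integrable lborel {x..} (\<lambda>y. exp (- A y) * k y)"
proof -
  have k_meas: "k \<in> borel_measurable borel"
    using k_cont by (rule borel_measurable_continuous_onI)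
  have A_cont: "continuous_on UNIV A"
    using A by (meson DERIV_isCont continuous_at_imp_continuous_on)
  have A_meas: "A \<in> borel_measurable borel"
    using A_cont by (rule borel_measurable_continuous_onI)
  have A_ge: "A 0 + l * y \<le> A y" if "0 \<le> y" for y
  proof -
    have "A 0 - l * 0 \<le> A y - l * y"
      by (rule DERIV_nonneg_imp_nondecreasing[OF that])
         (use k_ge in \<open>auto intro!: exI derivative_eq_intros A\<close>)
    then show ?thesis by simp
  qed
  have "filterlim (\<lambda>y. A 0 + l * y) at_top at_top"
    using l by (intro filterlim_tendsto_add_at_top[OF tendsto_const]
        filterlim_tendsto_pos_mult_at_top[OF tendsto_const] filterlim_ident)
  then have "filterlim A at_top at_top"
    by (rule filterlim_at_top_mono) (use A_ge in \<open>auto simp: eventually_at_top_linorder\<close>)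
  then have "filterlim (\<lambda>y. - A y) at_bot at_top"
    by (simp add: filterlim_uminus_at_bot)
  then have "((\<lambda>y. exp (- A y)) \<longlongrightarrow> 0) at_top"
    by (rule filterlim_compose[OF exp_at_bot])
  then have lim: "((\<lambda>y. - exp (- A y)) \<longlongrightarrow> - 0) at_top"
    by (intro tendsto_intros)
  have k_nonneg: "0 \<le> k y" for y
    using k_ge[of y] l by linarith
  have "(\<integral>\<^sup>+y. ennreal (exp (- A y) * k y) * indicator {x..} y \<partial>lborel) = - 0 - (- exp (- A x))"
    using lim
    by (intro nn_integral_FTC_atLeast[where F = "\<lambda>y. - exp (- A y)"])
       (use k_meas A_meas k_nonneg in \<open>auto intro!: derivative_eq_intros A\<close>)
  moreover have "(\<integral>\<^sup>+y. ennreal (norm (indicator {x..} y *\<^sub>R (exp (- A y) * k y))) \<partial>lborel)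
     = (\<integral>\<^sup>+y. ennreal (exp (- A y) * k y) * indicator {x..} y \<partial>lborel)"
    by (intro nn_integral_cong) (auto split: split_indicator simp: k_nonneg)
  ultimately show ?thesis
    unfolding set_integrable_def integrable_iff_bounded using k_meas A_meas by simp
qed

text \<open>\<open>w\<close> is the variation-of-constants solution of \<open>w' = k w - h\<close>,
  integrated back from plus infinity. The source \<open>h\<close> is bounded relative to
  \<open>k\<close> because it will contain jump rates, which need not be bounded.\<close>

locale flow_integral =
  fixes A k h w :: "real \<Rightarrow> real" and l B :: real
  assumes A: "\<And>y. (A has_real_derivative k y) (at y)"
    and k_cont: "continuous_on UNIV k" and k_ge: "\<And>y. l \<le> k y" and l: "0 < l"
    and h_meas: "h \<in> borel_measurable borel"
    and h_bound: "\<And>y. \<bar>h y\<bar> \<le> B * k y"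
    and w: "\<And>x. w x = (LBINT s:{0..}. exp (A x - A (x + s)) * h (x + s))"
begin

lemma phi_integrable: "set_integrable lborel {x..} (\<lambda>y. exp (- A y) * h y)"
proof (rule set_integrable_bound)
  show "set_integrable lborel {x..} (\<lambda>y. B * (exp (- A y) * k y))"
    using exp_minus_antiderivative_integrable[OF A k_cont k_ge l] by simp
  have "continuous_on UNIV A"
    using A by (meson DERIV_isCont continuous_at_imp_continuous_on)
  then have "A \<in> borel_measurable borel"
    by (rule borel_measurable_continuous_onI)
  then show "set_borel_measurable lborel {x..} (\<lambda>y. exp (- A y) * h y)"
    using h_meas unfolding set_borel_measurable_def by simp
  show "AE y in lborel. y \<in> {x..} \<longrightarrow> norm (exp (- A y) * h y) \<le> norm (B * (exp (- A y) * k y))"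
  proof (intro AE_I2 impI)
    fix y
    have "\<bar>h y\<bar> \<le> \<bar>B * k y\<bar>" using h_bound[of y] by linarith
    then show "norm (exp (- A y) * h y) \<le> norm (B * (exp (- A y) * k y))"
      by (simp add: abs_mult mult_left_mono mult.left_commute[of "\<bar>B\<bar>"])
  qed
qed

text \<open>The substitution \<open>y = x + s\<close> confines the dependence on \<open>x\<close> to
  the prefactor and the lower limit.\<close>

lemma w_eq: "w x = exp (A x) * (LBINT y:{x..}. exp (- A y) * h y)"
proof -
  have "(LBINT y:{x..}. exp (- A y) * h y)
     = (\<integral>s. indicator {x..} (x + 1 * s) *\<^sub>R (exp (- A (x + 1 * s)) * h (x + 1 * s)) \<partial>lborel)"
    unfolding set_lebesgue_integral_def
    by (subst lborel_integral_real_affine[where c = 1 and t = x]) simp_all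
  also have "\<dots> = (LBINT s:{0..}. exp (- A (x + s)) * h (x + s))"
    unfolding set_lebesgue_integral_def
    by (intro Bochner_Integration.integral_cong) (auto split: split_indicator)
  finally have eq: "(LBINT y:{x..}. exp (- A y) * h y) = (LBINT s:{0..}. exp (- A (x + s)) * h (x + s))" .
  have "w x = (LBINT s:{0..}. exp (A x) * (exp (- A (x + s)) * h (x + s)))"
    unfolding w by (simp add: exp_diff exp_minus divide_inverse mult.assoc)
  then show ?thesis
    by (simp add: eq)
qed

text \<open>A fixed base point \<open>x0\<close> turns the moving half-line into a constant minus an
  integral over a compact interval, to which the fundamental theorem applies.\<close>

lemma w_split:
  assumes "x0 \<le> x"
  shows "w x = exp (A x) * ((LBINT y:{x0..}. exp (- A y) * h y) - integral {x0..x} (\<lambda>y. exp (- A y) * h y))"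
proof -
  have int: "set_integrable lborel {x0..x} (\<lambda>y. exp (- A y) * h y)"
    by (rule set_integrable_subset[OF phi_integrable[of x0]]) auto
  have "(LBINT y:{x0..x} \<union> {x..}. exp (- A y) * h y)
     = (LBINT y:{x0..x}. exp (- A y) * h y) + (LBINT y:{x..}. exp (- A y) * h y)"
  proof (rule set_integral_Un_AE[OF _ _ _ int phi_integrable])
    show "AE y in lborel. \<not> (y \<in> {x0..x} \<and> y \<in> {x..})"
      using AE_lborel_singleton[of x] by eventually_elim auto
  qed auto
  moreover have "{x0..x} \<union> {x..} = {x0..}" using assms by auto
  ultimately show ?thesis
    unfolding w_eq set_borel_integral_eq_integral(2)[OF int, symmetric] by (simp add: algebra_simps)
qed

text \<open>An indefinite integral is continuous even for a discontinuous \<open>h\<close>. This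
  starts a bootstrap: the source will involve the resolvent itself, at first known only to be
  measurable.\<close>

lemma isCont_w: "isCont w x"
proof -
  have int: "(\<lambda>y. exp (- A y) * h y) integrable_on {x - 1..x + 1}"
    by (rule set_borel_integral_eq_integral(1), rule set_integrable_subset[OF phi_integrable[of "x - 1"]]) auto
  have "continuous_on {x - 1..x + 1} A"
    using A by (meson DERIV_isCont continuous_at_imp_continuous_on)
  then have "continuous_on {x - 1..x + 1} (\<lambda>x'. exp (A x') *
      ((LBINT y:{x - 1..}. exp (- A y) * h y) - integral {x - 1..x'} (\<lambda>y. exp (- A y) * h y)))"
    by (intro continuous_intros indefinite_integral_continuous_1[OF int])
  then have "continuous_on {x - 1..x + 1} w"
    by (rule continuous_on_cong[THEN iffD1, rotated 2]) (auto simp: w_split)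
  then show ?thesis
    by (rule continuous_on_interior) auto
qed

text \<open>Second stage of the bootstrap: once the source is continuous, \<open>w\<close> solves
  the equation classically.\<close>

lemma w_deriv:
  assumes h_cont: "continuous_on UNIV h"
  shows "(w has_real_derivative k x * w x - h x) (at x)"
proof -
  let ?phi = "\<lambda>y. exp (- A y) * h y" and ?I = "{x - 1..x + 1}"
  have "continuous_on ?I A"
    using A by (meson DERIV_isCont continuous_at_imp_continuous_on)
  then have "continuous_on ?I ?phi"
    using h_cont by (intro continuous_intros) (auto intro: continuous_on_subset)
  then have "((\<lambda>x'. integral {x - 1..x'} ?phi) has_real_derivative ?phi x) (at x within ?I)"
    by (rule integral_has_real_derivative) auto
  then have d: "((\<lambda>x'. integral {x - 1..x'} ?phi) has_real_derivative ?phi x) (at x)"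
    by (subst (asm) at_within_interior) auto
  have "((\<lambda>x'. exp (A x') * ((LBINT y:{x - 1..}. ?phi y) - integral {x - 1..x'} ?phi))
      has_real_derivative k x * w x - h x) (at x)"
    by (rule derivative_eq_intros A d refl)+ (auto simp: w_split[of "x - 1" x] algebra_simps exp_minus)
  then show ?thesis
    by (rule has_field_derivative_transform_within_open[where S = "{x - 1<..<x + 1}"])
       (auto simp: w_split[of "x - 1"])
qed

end

text \<open>Decay of \<open>F\<close> at infinity is not at hand, so the integral of
  \<open>F'\<close> is averaged over shifts by \<open>t\<close> in \<open>[0, 1]\<close>. Fubini
  turns it into the integral of \<open>F (x + 1) - F x\<close>, which vanishes by translation
  invariance.\<close>

lemma integral_deriv_eq_0:
  fixes F F' :: "real \<Rightarrow> real"
  assumes F: "\<And>x. (F has_real_derivative F' x) (at x)"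
    and F'_cont: "continuous_on UNIV F'"
    and int_F: "integrable lborel F" and int_F': "integrable lborel F'"
  shows "(\<integral>x. F' x \<partial>lborel) = 0"
proof -
  have F'_meas [measurable]: "F' \<in> borel_measurable borel"
    using F'_cont by (rule borel_measurable_continuous_onI)
  have shift: "integrable lborel (\<lambda>x. F' (x + t))" "(\<integral>x. F' (x + t) \<partial>lborel) = (\<integral>x. F' x \<partial>lborel)"
    "(\<integral>x. \<bar>F' (x + t)\<bar> \<partial>lborel) = (\<integral>x. \<bar>F' x\<bar> \<partial>lborel)" for t
    using lborel_integrable_real_affine[OF int_F', of 1 t] lborel_integral_real_affine[of 1 F' t]
      lborel_integral_real_affine[of 1 "\<lambda>x. \<bar>F' x\<bar>" t]
    by (simp_all add: add.commute)
  let ?J = "\<lambda>t x. indicator {0..1} t * F' (x + t)"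
  have "integrable (lborel \<Otimes>\<^sub>M lborel) (\<lambda>(t, x). ?J t x)"
  proof (rule lborel_pair.Fubini_integrable)
    show "integrable lborel (\<lambda>t. \<integral>x. norm (case (t, x) of (t, x) \<Rightarrow> ?J t x) \<partial>lborel)"
      by (simp add: abs_mult shift)
    show "AE t in lborel. integrable lborel (\<lambda>x. case (t, x) of (t, x) \<Rightarrow> ?J t x)"
      using shift by simp
  qed simp
  note Fubini = lborel_pair.Fubini_integral[OF this]
  have inner: "(\<integral>t. ?J t x \<partial>lborel) = F (x + 1) - F x" for x
  proof -
    have "(\<integral>t. F' (x + t) * indicator {0..1} t \<partial>lborel) = F (x + 1) - F (x + 0)"
    proof (rule integral_FTC_Icc_real)
      show "((\<lambda>t. F (x + t)) has_real_derivative F' (x + t)) (at t)" for t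
        using F[of "x + t"] by (simp add: DERIV_shift add.commute)
      show "isCont (\<lambda>t. F' (x + t)) t" for t
      proof -
        have "continuous_on UNIV (\<lambda>t. F' (x + t))"
          by (rule continuous_on_compose2[OF F'_cont]) (auto intro!: continuous_intros)
        then show ?thesis by (simp add: continuous_on_eq_continuous_at)
      qed
    qed simp
    then show ?thesis by (simp add: mult.commute)
  qed
  have "(\<integral>x. F' x \<partial>lborel) = (\<integral>t. (\<integral>x. ?J t x \<partial>lborel) \<partial>lborel)"
    by (simp add: shift)
  also have "\<dots> = (\<integral>x. (\<integral>t. ?J t x \<partial>lborel) \<partial>lborel)"
    by (rule Fubini[symmetric])
  also have "\<dots> = (\<integral>x. F (x + 1) - F x \<partial>lborel)"
    by (simp only: inner)
  also have "\<dots> = 0"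
    using lborel_integrable_real_affine[OF int_F, of 1 1] lborel_integral_real_affine[of 1 F 1] int_F
    by (simp add: add.commute)
  finally show ?thesis .
qed

subsection \<open>The resolvent equation\<close>

lemma space_zz_M: "space zz_M = zz_E"
  by (simp add: zz_M_def zz_E_def space_pair_measure)

lemma measurable_zz_M_Pair [measurable]:
  "v \<in> {-1, 1} \<Longrightarrow> (\<lambda>x. (x, v)) \<in> measurable borel zz_M"
  unfolding zz_M_def by (intro measurable_Pair) auto

lemma has_bochner_integral_exp_atLeast:
  fixes l :: real
  assumes "0 < l"
  shows "has_bochner_integral lborel (\<lambda>t. indicator {0..} t * exp (- l * t)) (1 / l)"
proof (rule has_bochner_integral_nn_integral)
  have "((\<lambda>t. exp (- l * t)) \<longlongrightarrow> 0) at_top"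
    by (intro filterlim_compose[OF exp_at_bot] filterlim_tendsto_neg_mult_at_bot[OF tendsto_const] filterlim_ident)
       (use assms in auto)
  then have lim: "((\<lambda>t. - (1 / l) * exp (- l * t)) \<longlongrightarrow> - (1 / l) * 0) at_top"
    by (intro tendsto_intros)
  have "(\<integral>\<^sup>+t. ennreal (exp (- l * t)) * indicator {0..} t \<partial>lborel)
      = ennreal (- (1 / l) * 0 - (- (1 / l) * exp (- l * 0)))"
    by (intro nn_integral_FTC_atLeast[where F = "\<lambda>t. - (1 / l) * exp (- l * t)"] lim)
       (use assms in \<open>auto intro!: derivative_eq_intros\<close>)
  then show "(\<integral>\<^sup>+t. ennreal (indicator {0..} t * exp (- l * t)) \<partial>lborel) = ennreal (1 / l)"
    by (subst (asm) nn_integral_cong[where v = "\<lambda>t. ennreal (indicator {0..} t * exp (- l * t))"])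
       (auto split: split_indicator)
qed (use assms in auto)

locale zigzag =
  fixes lam :: "real \<times> real \<Rightarrow> real" and lbar l :: real
    and K :: "real \<Rightarrow> real \<times> real \<Rightarrow> (real \<times> real) measure"
  assumes kernel: "zz_kernel lam lbar K"
    and lam_cont: "\<And>v. v \<in> {-1, 1} \<Longrightarrow> continuous_on UNIV (\<lambda>x. lam (x, v))"
    and lam_nonneg: "\<And>z. z \<in> zz_E \<Longrightarrow> 0 \<le> lam z"
    and lbar_nonneg: "0 \<le> lbar" and l_pos: "0 < l"
begin

definition resolvent :: "(real \<times> real \<Rightarrow> real) \<Rightarrow> real \<times> real \<Rightarrow> real" where
  "resolvent g z = (LBINT t:{0..}. exp (- l * t) * zz_semigroup K t g z)"

lemma lam_measurable [measurable]: "v \<in> {-1, 1} \<Longrightarrow> (\<lambda>x. lam (x, v)) \<in> borel_measurable borel"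
  using lam_cont by (rule borel_measurable_continuous_onI)

text \<open>The kernel is only constrained for nonnegative times; composing with \<^term>\<open>max 0\<close> makes it
  measurable on the whole line.\<close>

lemma K_measurable: "(\<lambda>(t, z). K (max 0 t) z) \<in> borel \<Otimes>\<^sub>M zz_M \<rightarrow>\<^sub>M prob_algebra zz_M"
proof -
  have K: "(\<lambda>(t, z). K t z) \<in> restrict_space borel {0..} \<Otimes>\<^sub>M zz_M \<rightarrow>\<^sub>M prob_algebra zz_M"
    using kernel by (simp add: zz_kernel_def)
  have "(\<lambda>p. (max 0 (fst p), snd p)) \<in> borel \<Otimes>\<^sub>M zz_M \<rightarrow>\<^sub>M restrict_space borel {0::real..} \<Otimes>\<^sub>M zz_M"
    by (intro measurable_Pair measurable_restrict_space2) auto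
  from measurable_compose[OF this K] show ?thesis
    by (simp add: case_prod_beta')
qed

lemma K_prob_space:
  assumes "0 \<le> t" "z \<in> zz_E"
  shows "prob_space (K t z)" "sets (K t z) = sets zz_M" "space (K t z) = zz_E"
proof -
  have "K (max 0 t) z \<in> space (prob_algebra zz_M)"
    using measurable_space[OF K_measurable, of "(t, z)"] assms
    by (simp add: space_pair_measure space_zz_M)
  then show "prob_space (K t z)" "sets (K t z) = sets zz_M"
    using assms by (auto simp: space_prob_algebra)
  then show "space (K t z) = zz_E"
    using sets_eq_imp_space_eq[of "K t z" zz_M] by (simp add: space_zz_M)
qed

lemma semigroup_measurable:
  assumes "g \<in> borel_measurable zz_M"
  shows "(\<lambda>(t, z). zz_semigroup K (max 0 t) g z) \<in> borel_measurable (borel \<Otimes>\<^sub>M zz_M)"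
  using measurable_compose[OF measurable_prob_algebraD[OF K_measurable]
      integral_measurable_subprob_algebra[OF assms]]
  by (simp add: zz_semigroup_def case_prod_beta')

lemma semigroup_bound:
  assumes g: "g \<in> borel_measurable zz_M" "\<And>z. \<bar>g z\<bar> \<le> M" and tz: "0 \<le> t" "z \<in> zz_E"
  shows "\<bar>zz_semigroup K t g z\<bar> \<le> M"
proof -
  interpret prob_space "K t z" by (rule K_prob_space[OF tz])
  have [measurable]: "g \<in> borel_measurable (K t z)"
    using g(1) K_prob_space(2)[OF tz] by (simp cong: measurable_cong_sets)
  have "integrable (K t z) g"
    by (rule integrable_const_bound[where B = M]) (use g in auto)
  then have "\<bar>\<integral>w. g w \<partial>K t z\<bar> \<le> (\<integral>w. \<bar>g w\<bar> \<partial>K t z)" by simp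
  also have "\<dots> \<le> M"
    by (rule integral_le_const) (use g \<open>integrable _ _\<close> in auto)
  finally show ?thesis by (simp add: zz_semigroup_def)
qed

lemma resolvent_eq_max:
  "resolvent g z = (\<integral>t. indicator {0..} t * exp (- l * t) * zz_semigroup K (max 0 t) g z \<partial>lborel)"
  unfolding resolvent_def set_lebesgue_integral_def
  by (intro Bochner_Integration.integral_cong) (auto split: split_indicator)

lemma resolvent_measurable:
  assumes "g \<in> borel_measurable zz_M"
  shows "resolvent g \<in> borel_measurable zz_M"
proof -
  have [measurable]: "(\<lambda>p. zz_semigroup K (max 0 (snd p)) g (fst p)) \<in> borel_measurable (zz_M \<Otimes>\<^sub>M borel)"
    using measurable_compose[OF measurable_pair_swap' semigroup_measurable[OF assms]]
    by (simp add: case_prod_beta')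
  have "(\<lambda>z. \<integral>t. indicator {0..} t * exp (- l * t) * zz_semigroup K (max 0 t) g z \<partial>lborel)
      \<in> borel_measurable zz_M"
    by (rule lborel.borel_measurable_lebesgue_integral)
       (simp add: case_prod_beta' cong: measurable_cong_sets)
  then show ?thesis
    by (simp add: resolvent_eq_max[abs_def])
qed

lemma semigroup_section_measurable [measurable]:
  assumes "g \<in> borel_measurable zz_M" "z \<in> zz_E"
  shows "(\<lambda>t. zz_semigroup K (max 0 t) g z) \<in> borel_measurable borel"
proof -
  have "(\<lambda>t. (t, z)) \<in> borel \<rightarrow>\<^sub>M borel \<Otimes>\<^sub>M zz_M"
    using assms(2) by (simp add: space_zz_M)
  from measurable_compose[OF this semigroup_measurable[OF assms(1)]] show ?thesis
    by simp
qed

lemma exp_semigroup_bound: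
  assumes g: "g \<in> borel_measurable zz_M" "\<And>z. \<bar>g z\<bar> \<le> M" and z: "z \<in> zz_E"
  shows "\<bar>indicator {0..} t * exp (- l * t) * zz_semigroup K (max 0 t) g z\<bar>
      \<le> M * (indicator {0..} t * exp (- l * t))"
  using semigroup_bound[OF g _ z, of "max 0 t"]
  by (auto split: split_indicator simp: abs_mult intro!: mult_left_mono)

lemma exp_semigroup_integrable:
  assumes g: "g \<in> borel_measurable zz_M" "\<And>z. \<bar>g z\<bar> \<le> M" and z: "z \<in> zz_E"
  shows "integrable lborel (\<lambda>t. indicator {0..} t * exp (- l * t) * zz_semigroup K (max 0 t) g z)"
proof (rule Bochner_Integration.integrable_bound)
  show "integrable lborel (\<lambda>t. M * (indicator {0..} t * exp (- l * t)))"
    using has_bochner_integral_exp_atLeast[OF l_pos] by (auto simp: has_bochner_integral_iff)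
  have [measurable]: "(\<lambda>t. zz_semigroup K (max 0 t) g z) \<in> borel_measurable borel"
    using g(1) z by measurable
  show "(\<lambda>t. indicator {0..} t * exp (- l * t) * zz_semigroup K (max 0 t) g z) \<in> borel_measurable lborel"
    by measurable
  show "AE t in lborel. norm (indicator {0..} t * exp (- l * t) * zz_semigroup K (max 0 t) g z)
      \<le> norm (M * (indicator {0..} t * exp (- l * t)))"
    using order_trans[OF exp_semigroup_bound[OF g z] abs_ge_self] by auto
qed

lemma resolvent_bound:
  assumes g: "g \<in> borel_measurable zz_M" "\<And>z. \<bar>g z\<bar> \<le> M" and z: "z \<in> zz_E"
  shows "\<bar>resolvent g z\<bar> \<le> M / l"
proof -
  have "\<bar>resolvent g z\<bar> \<le> (\<integral>t. M * (indicator {0..} t * exp (- l * t)) \<partial>lborel)"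
    unfolding resolvent_eq_max
    by (rule order_trans[OF integral_abs_bound], rule integral_mono)
       (use has_bochner_integral_exp_atLeast[OF l_pos] exp_semigroup_bound[OF g z]
          exp_semigroup_integrable[OF g z] in \<open>auto simp: has_bochner_integral_iff\<close>)
  also have "\<dots> = M / l"
    using has_bochner_integral_exp_atLeast[OF l_pos] by (simp add: has_bochner_integral_iff)
  finally show ?thesis .
qed

text \<open>The source \<open>h\<close> of the flow integral: the observable plus the gains at an
  event, a flip leading to \<open>- v\<close> and a refreshment to the mean over both velocities.
  The matching loss rates \<open>lam\<close> and \<open>lbar\<close> sit in the exponent
  \<open>A\<close>.\<close>

definition jump_source :: "(real \<times> real \<Rightarrow> real) \<Rightarrow> real \<times> real \<Rightarrow> real" where
  "jump_source g = (\<lambda>(x, v). g (x, v) + lam (x, v) * resolvent g (x, - v)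
     + lbar * (1/2 * resolvent g (x, 1) + 1/2 * resolvent g (x, -1)))"

text \<open>Laplace transform of the first-jump equation.  Writing the starting point as \<open>(v y, v)\<close>
  makes the flow a translation of \<open>y\<close> for both velocities.\<close>

lemma resolvent_equation:
  assumes v: "v \<in> {-1, 1}" and g: "g \<in> borel_measurable zz_M" "\<And>z. \<bar>g z\<bar> \<le> M"
    and A: "\<And>y. (A has_real_derivative l + lbar + lam (v * y, v)) (at y)"
  shows "resolvent g (v * y, v) = (LBINT s:{0..}. exp (A y - A (y + s)) * jump_source g (v * (y + s), v))"
proof -
  have v': "- v \<in> {-1, 1}" using v by auto
  have E: "(x, 1) \<in> zz_E" "(x, -1) \<in> zz_E" "(x, v) \<in> zz_E" "(x, -v) \<in> zz_E" for x
    using v by (auto simp: zz_E_def)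
  let ?q = "\<lambda>s. v * (y + s)"
  let ?P = "\<lambda>r z. zz_semigroup K r g z"
  define k where "k y = l + lbar + lam (v * y, v)" for y
  \<comment> \<open>\<open>D s\<close> is discount times survival probability up to time
    \<open>s\<close>; \<open>G s r\<close> weighs the events at \<open>s\<close> with remaining time
    \<open>r\<close>; \<open>W\<close> adds the discount over \<open>r\<close> and vanishes for
    negative \<open>r\<close>; \<open>T s\<close> will be the integral of
    \<open>W s\<close>.\<close>
  define D where "D s = exp (A y - A (y + s))" for s
  define G where "G s r = lam (?q s, v) * ?P r (?q s, - v)
     + lbar * (1/2 * ?P r (?q s, 1) + 1/2 * ?P r (?q s, -1))" for s r
  define W where "W s r = indicator {0..} r * exp (- l * r) * G s (max 0 r)" for s r
  define T where "T s = lam (?q s, v) * resolvent g (?q s, - v)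
     + lbar * (1/2 * resolvent g (?q s, 1) + 1/2 * resolvent g (?q s, -1))" for s
  have M: "0 \<le> M" using g(2)[of "(0,0)"] by linarith
  have A_cont: "continuous_on UNIV A"
    using A by (meson DERIV_isCont continuous_at_imp_continuous_on)
  have [measurable]: "A \<in> borel_measurable borel"
    using A_cont by (rule borel_measurable_continuous_onI)
  have k_cont: "continuous_on UNIV k"
    unfolding k_def by (intro continuous_intros continuous_on_compose2[OF lam_cont[OF v]]) auto
  have k_ge: "l \<le> k y" for y
    using lam_nonneg[OF E(3)] lbar_nonneg by (simp add: k_def)
  have D_meas [measurable]: "D \<in> borel_measurable borel"
    unfolding D_def by measurable
  have lam_q_meas [measurable]: "(\<lambda>s. lam (?q s, v)) \<in> borel_measurable borel"
    using measurable_compose[OF _ lam_measurable[OF v], of ?q borel] by simp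
  have g_q_meas [measurable]: "(\<lambda>s. g (?q s, v)) \<in> borel_measurable borel"
    using measurable_compose[OF _ measurable_compose[OF measurable_zz_M_Pair[OF v] g(1)], of ?q borel] by simp
  have P_meas: "(\<lambda>p. ?P (max 0 (snd p)) (?q (fst p), u)) \<in> borel_measurable (borel \<Otimes>\<^sub>M borel)"
    if u: "u \<in> {-1, 1}" for u
  proof -
    have "(\<lambda>p. (?q (fst p), u)) \<in> borel \<Otimes>\<^sub>M borel \<rightarrow>\<^sub>M zz_M"
      by (rule measurable_compose[OF _ measurable_zz_M_Pair[OF u]]) simp
    then have "(\<lambda>p. (snd p, (?q (fst p), u))) \<in> borel \<Otimes>\<^sub>M borel \<rightarrow>\<^sub>M borel \<Otimes>\<^sub>M zz_M"
      by measurable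
    from measurable_compose[OF this semigroup_measurable[OF g(1)]] show ?thesis by simp
  qed
  have W_meas [measurable]: "case_prod W \<in> borel_measurable (borel \<Otimes>\<^sub>M borel)"
    unfolding W_def G_def case_prod_beta'
    using P_meas[OF v'] P_meas[of 1] P_meas[of "-1"] by simp
  have W_int: "integrable lborel (W s)" "(\<integral>r. W s r \<partial>lborel) = T s" for s
  proof -
    have *: "W s = (\<lambda>r. lam (?q s, v) * (indicator {0..} r * exp (- l * r) * ?P (max 0 r) (?q s, - v))
       + lbar * (1/2 * (indicator {0..} r * exp (- l * r) * ?P (max 0 r) (?q s, 1))
       + 1/2 * (indicator {0..} r * exp (- l * r) * ?P (max 0 r) (?q s, -1))))"
      by (auto simp: W_def G_def algebra_simps)
    note ints = exp_semigroup_integrable[OF g E(1)] exp_semigroup_integrable[OF g E(2)]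
      exp_semigroup_integrable[OF g E(4)]
    show "integrable lborel (W s)"
      unfolding * by (intro Bochner_Integration.integrable_add integrable_mult_right ints)
    show "(\<integral>r. W s r \<partial>lborel) = T s"
      unfolding * T_def resolvent_eq_max
      by (subst Bochner_Integration.integral_add | intro Bochner_Integration.integrable_add integrable_mult_right ints
          | subst integral_mult_right_zero)+ simp
  qed
  have W_bound: "\<bar>W s r\<bar> \<le> M * k (y + s) * (indicator {0..} r * exp (- l * r))" for s r
  proof -
    note bds = semigroup_bound[OF g _ E(1)[of "?q s"], of "max 0 r"]
      semigroup_bound[OF g _ E(2)[of "?q s"], of "max 0 r"]
      semigroup_bound[OF g _ E(4)[of "?q s"], of "max 0 r"]
    have "\<bar>1/2 * ?P (max 0 r) (?q s, 1) + 1/2 * ?P (max 0 r) (?q s, -1)\<bar> \<le> M"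
      using bds by simp
    note avg = this
    have "\<bar>G s (max 0 r)\<bar> \<le> \<bar>lam (?q s, v) * ?P (max 0 r) (?q s, - v)\<bar>
       + \<bar>lbar * (1/2 * ?P (max 0 r) (?q s, 1) + 1/2 * ?P (max 0 r) (?q s, -1))\<bar>"
      unfolding G_def by (rule abs_triangle_ineq)
    also have "\<dots> \<le> lam (?q s, v) * M + lbar * M"
      unfolding abs_mult abs_of_nonneg[OF lam_nonneg[OF E(3)]] abs_of_nonneg[OF lbar_nonneg]
      using bds by (intro add_mono mult_left_mono avg lam_nonneg E lbar_nonneg) auto
    also have "\<dots> \<le> M * k (y + s)"
      using M l_pos by (simp add: k_def algebra_simps)
    finally show ?thesis
      by (auto simp: W_def abs_mult mult.commute intro!: mult_right_mono split: split_indicator)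
  qed
  \<comment> \<open>The discount adds \<open>l\<close> to the event rate, so that \<open>A\<close>
    is a primitive of the exponent.\<close>
  have surv: "exp (- l * s) * zz_surv (\<lambda>w. lam w + lbar) (v * y, v) s = D s" if "0 \<le> s" for s
  proof -
    have pos: "v * y + u * v = v * (y + u)" for u by (simp add: algebra_simps)
    have "(LBINT u=0..s. lam (v * (y + u), v) + lbar) = (A (y + s) - l * s) - (A (y + 0) - l * 0)"
      unfolding zero_ereal_def
    proof (rule interval_integral_FTC_finite[where F = "\<lambda>u. A (y + u) - l * u"])
      show "continuous_on {min 0 s..max 0 s} (\<lambda>u. lam (v * (y + u), v) + lbar)"
        by (intro continuous_intros continuous_on_compose2[OF lam_cont[OF v]]) auto
      have "((\<lambda>u. A (y + u) - l * u) has_real_derivative lam (v * (y + u), v) + lbar) (at u)" for u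
        by (rule derivative_eq_intros DERIV_chain2[OF A] refl)+ simp
      then show "((\<lambda>u. A (y + u) - l * u) has_vector_derivative lam (v * (y + u), v) + lbar)
          (at u within {min 0 s..max 0 s})" for u
        by (simp add: has_real_derivative_iff_has_vector_derivative has_vector_derivative_at_within)
    qed
    then show ?thesis
      by (simp add: zz_surv_def D_def pos exp_add[symmetric])
  qed
  \<comment> \<open>Splitting \<open>exp (- l * t)\<close> as
    \<open>exp (- l * s) * exp (- l * (t - s))\<close> makes the discounted first-jump equation a
    convolution. Since \<open>W\<close> vanishes for negative remaining time, \<open>s\<close> may
    range over the whole half-line.\<close>
  have fj: "indicator {0..} t * exp (- l * t) * ?P (max 0 t) (v * y, v)
     = indicator {0..} t * (D t * g (?q t, v)) + (\<integral>s. indicator {0..} s * D s * W s (t - s) \<partial>lborel)" for t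
  proof (cases "0 \<le> t")
    case False
    then have "(\<lambda>s. indicator {0..} s * D s * W s (t - s)) = (\<lambda>s. 0)"
      by (auto simp: W_def fun_eq_iff split: split_indicator)
    with False show ?thesis by simp
  next
    case t: True
    have pos: "v * y + u * v = v * (y + u)" for u by (simp add: algebra_simps)
    have "bounded (range g)"
      using g(2) by (auto simp: bounded_iff)
    with kernel t g(1) E(3)[of "v * y"] have
      "?P t (v * y, v) = zz_surv (\<lambda>w. lam w + lbar) (v * y, v) t * g (?q t, v)
        + (LBINT s=0..t. zz_surv (\<lambda>w. lam w + lbar) (v * y, v) s * G s (t - s))"
      unfolding zz_kernel_def zz_semigroup_def G_def by (simp add: pos)
    also have "(LBINT s=0..t. zz_surv (\<lambda>w. lam w + lbar) (v * y, v) s * G s (t - s))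
        = (LBINT s:{0..t}. zz_surv (\<lambda>w. lam w + lbar) (v * y, v) s * G s (t - s))"
      using t by (simp add: zero_ereal_def interval_integral_Icc)
    finally have "exp (- l * t) * ?P t (v * y, v) = D t * g (?q t, v)
        + (LBINT s:{0..t}. exp (- l * t) * (zz_surv (\<lambda>w. lam w + lbar) (v * y, v) s * G s (t - s)))"
      by (simp add: surv[OF t, symmetric] distrib_left mult.assoc)
    also have "(LBINT s:{0..t}. exp (- l * t) * (zz_surv (\<lambda>w. lam w + lbar) (v * y, v) s * G s (t - s)))
        = (\<integral>s. indicator {0..} s * D s * W s (t - s) \<partial>lborel)"
      unfolding set_lebesgue_integral_def
    proof (intro Bochner_Integration.integral_cong refl)
      fix s
      have "exp (- l * t) = exp (- l * s) * exp (- l * (t - s))"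
        by (simp add: exp_add[symmetric] algebra_simps)
      then show "indicator {0..t} s *\<^sub>R (exp (- l * t) * (zz_surv (\<lambda>w. lam w + lbar) (v * y, v) s * G s (t - s)))
          = indicator {0..} s * D s * W s (t - s)"
        using surv[of s] by (auto simp: W_def max_absorb2 split: split_indicator)
    qed
    finally show ?thesis using t by (simp add: max_absorb2)
  qed
  have kD_int: "integrable lborel (\<lambda>s. indicator {0..} s * (D s * k (y + s)))"
  proof -
    have "integrable lborel (\<lambda>z. indicator {y..} z *\<^sub>R (exp (- A z) * k z))"
      using exp_minus_antiderivative_integrable[of A k l y] A k_cont k_ge l_pos
      by (simp add: set_integrable_def k_def)
    from lborel_integrable_real_affine[OF this, of 1 y]
    have "integrable lborel (\<lambda>s. exp (A y) * (indicator {y..} (y + s) * (exp (- A (y + s)) * k (y + s))))"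
      by simp
    then show ?thesis
      by (rule Bochner_Integration.integrable_cong[THEN iffD1, rotated 2])
         (auto simp: D_def exp_diff exp_minus divide_inverse split: split_indicator)
  qed
  have Wshift: "(\<integral>t. \<phi> (W s (t - s)) \<partial>lborel) = (\<integral>r. \<phi> (W s r) \<partial>lborel)" for s and \<phi> :: "real \<Rightarrow> real"
    using lborel_integral_real_affine[of 1 "\<lambda>t. \<phi> (W s (t - s))" s] by simp
  have Wshift_int: "integrable lborel (\<lambda>t. W s (t - s))" for s
    using lborel_integrable_real_affine[OF W_int(1)[of s], of 1 "- s"] by simp
  \<comment> \<open>Fubini is justified by integrating over \<open>t\<close> first: the inner
    integral is at most \<open>M / l * k (y + s)\<close>, and \<open>kD_int\<close> covers this
    against \<open>D\<close>.\<close>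
  have J_int: "integrable (lborel \<Otimes>\<^sub>M lborel) (\<lambda>(s, t). indicator {0..} s * D s * W s (t - s))"
  proof (rule lborel_pair.Fubini_integrable)
    have [measurable]: "(\<lambda>p. W (fst p) (snd p - fst p)) \<in> borel_measurable (borel \<Otimes>\<^sub>M borel)"
      using measurable_compose[OF _ W_meas, of "\<lambda>p. (fst p, snd p - fst p)" "borel \<Otimes>\<^sub>M borel"] by simp
    show "(\<lambda>(s, t). indicator {0..} s * D s * W s (t - s)) \<in> borel_measurable (lborel \<Otimes>\<^sub>M lborel)"
      by (simp add: case_prod_beta' cong: measurable_cong_sets)
    show "AE s in lborel. integrable lborel (\<lambda>t. case (s, t) of (s, t) \<Rightarrow> indicator {0..} s * D s * W s (t - s))"
      using Wshift_int by simp
    have eq: "(\<integral>t. norm (case (s, t) of (s, t) \<Rightarrow> indicator {0..} s * D s * W s (t - s)) \<partial>lborel)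
        = indicator {0..} s * D s * (\<integral>r. \<bar>W s r\<bar> \<partial>lborel)" for s
      using Wshift[of abs] by (simp add: abs_mult D_def)
    have [measurable]: "(\<lambda>s. \<integral>r. \<bar>W s r\<bar> \<partial>lborel) \<in> borel_measurable borel"
      by (rule lborel.borel_measurable_lebesgue_integral) (use W_meas in \<open>simp add: case_prod_beta' cong: measurable_cong_sets\<close>)
    have le: "(\<integral>r. \<bar>W s r\<bar> \<partial>lborel) \<le> M / l * k (y + s)" for s
    proof -
      have "(\<integral>r. \<bar>W s r\<bar> \<partial>lborel) \<le> (\<integral>r. M * k (y + s) * (indicator {0..} r * exp (- l * r)) \<partial>lborel)"
        using has_bochner_integral_exp_atLeast[OF l_pos] W_int W_bound
        by (intro integral_mono) (auto simp: has_bochner_integral_iff)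
      then show ?thesis
        using has_bochner_integral_exp_atLeast[OF l_pos] by (simp add: has_bochner_integral_iff)
    qed
    show "integrable lborel (\<lambda>s. \<integral>t. norm (case (s, t) of (s, t) \<Rightarrow> indicator {0..} s * D s * W s (t - s)) \<partial>lborel)"
      unfolding eq
    proof (rule Bochner_Integration.integrable_bound)
      show "integrable lborel (\<lambda>s. M / l * (indicator {0..} s * (D s * k (y + s))))"
        using kD_int by simp
      show "AE s in lborel. norm (indicator {0..} s * D s * (\<integral>r. \<bar>W s r\<bar> \<partial>lborel))
          \<le> norm (M / l * (indicator {0..} s * (D s * k (y + s))))"
      proof (intro AE_I2)
        fix s
        have "indicator {0..} s * D s * (\<integral>r. \<bar>W s r\<bar> \<partial>lborel) \<le> indicator {0..} s * D s * (M / l * k (y + s))"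
          by (intro mult_left_mono le) (auto simp: D_def)
        moreover have "0 \<le> indicator {0..} s * D s * (\<integral>r. \<bar>W s r\<bar> \<partial>lborel)"
          by (intro mult_nonneg_nonneg) (auto simp: D_def)
        moreover have "indicator {0..} s * D s * (M / l * k (y + s)) = M / l * (indicator {0..} s * (D s * k (y + s)))"
          by (simp only: mult_ac)
        ultimately show "norm (indicator {0..} s * D s * (\<integral>r. \<bar>W s r\<bar> \<partial>lborel))
          \<le> norm (M / l * (indicator {0..} s * (D s * k (y + s))))"
          unfolding real_norm_def by linarith
      qed
    qed simp
  qed
  \<comment> \<open>The same majorant serves here, because \<open>k \<ge> l\<close> gives
    \<open>M \<le> M / l * k\<close>.\<close>
  have int1: "integrable lborel (\<lambda>t. indicator {0..} t * (D t * g (?q t, v)))"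
  proof (rule Bochner_Integration.integrable_bound)
    show "integrable lborel (\<lambda>s. M / l * (indicator {0..} s * (D s * k (y + s))))"
      using kD_int by simp
    show "AE t in lborel. norm (indicator {0..} t * (D t * g (?q t, v)))
        \<le> norm (M / l * (indicator {0..} t * (D t * k (y + t))))"
    proof (intro AE_I2)
      fix t
      have "\<bar>g (?q t, v)\<bar> \<le> M * 1" using g(2) by simp
      also have "\<dots> \<le> M * (k (y + t) / l)"
        using M k_ge[of "y + t"] l_pos by (intro mult_left_mono) (auto simp: field_simps)
      finally have "D t * \<bar>g (?q t, v)\<bar> \<le> D t * (M * (k (y + t) / l))"
        by (intro mult_left_mono) (auto simp: D_def)
      then show "norm (indicator {0..} t * (D t * g (?q t, v)))
          \<le> norm (M / l * (indicator {0..} t * (D t * k (y + t))))"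
        using M k_ge[of "y + t"] l_pos
        by (auto simp: abs_mult D_def mult_ac split: split_indicator)
    qed
  qed simp
  have J_fst: "(\<integral>t. indicator {0..} s * D s * W s (t - s) \<partial>lborel) = indicator {0..} s * (D s * T s)" for s
    using Wshift[of "\<lambda>u. u" s] W_int(2)[of s] by simp
  have int2: "integrable lborel (\<lambda>s. indicator {0..} s * (D s * T s))"
    using lborel_pair.integrable_fst[OF J_int] by (simp only: J_fst prod.case)
  \<comment> \<open>Exchanging the integrals, the shift in \<open>t\<close> disappears and the
    convolution becomes the integral of \<open>D s * T s\<close>.\<close>
  have "resolvent g (v * y, v) = (\<integral>t. indicator {0..} t * (D t * g (?q t, v)) \<partial>lborel)
      + (\<integral>t. (\<integral>s. indicator {0..} s * D s * W s (t - s) \<partial>lborel) \<partial>lborel)"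
    unfolding resolvent_eq_max fj
    by (rule Bochner_Integration.integral_add[OF int1]) (rule lborel_pair.integrable_snd[OF J_int])
  also have "(\<integral>t. (\<integral>s. indicator {0..} s * D s * W s (t - s) \<partial>lborel) \<partial>lborel)
      = (\<integral>s. indicator {0..} s * (D s * T s) \<partial>lborel)"
    using lborel_pair.Fubini_integral[OF J_int] by (simp only: J_fst)
  also have "(\<integral>t. indicator {0..} t * (D t * g (?q t, v)) \<partial>lborel) + \<dots>
      = (\<integral>s. indicator {0..} s * (D s * g (?q s, v)) + indicator {0..} s * (D s * T s) \<partial>lborel)"
    by (rule Bochner_Integration.integral_add[OF int1 int2, symmetric])
  also have "\<dots> = (LBINT s:{0..}. exp (A y - A (y + s)) * jump_source g (v * (y + s), v))"
    unfolding set_lebesgue_integral_def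
    by (intro Bochner_Integration.integral_cong) (auto simp: D_def T_def jump_source_def algebra_simps)
  finally show ?thesis .
qed

end

subsection \<open>The target measure and the resolvent as a system of differential equations\<close>

lemma borel_measurable_zz_M_I:
  assumes "\<And>v. v \<in> {-1, 1} \<Longrightarrow> (\<lambda>x. f (x, v)) \<in> measurable borel N"
  shows "f \<in> measurable zz_M N"
  unfolding zz_M_def measurable_pair_swap_iff[of f]
  by (rule measurable_pair_measure_countable1) (use assms in auto)

lemma nn_integral_zz_M:
  assumes "f \<in> borel_measurable zz_M"
  shows "(\<integral>\<^sup>+z. f z \<partial>zz_M) = (\<integral>\<^sup>+x. f (x, 1) \<partial>lborel) + (\<integral>\<^sup>+x. f (x, -1) \<partial>lborel)"
proof -
  interpret C: sigma_finite_measure "count_space {-1, 1 :: real}"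
    by (rule sigma_finite_measure_count_space_finite) simp
  have sect: "(\<lambda>x. f (x, v)) \<in> borel_measurable lborel" if "v \<in> {-1, 1}" for v
    using measurable_compose[OF measurable_zz_M_Pair[OF that] assms] by simp
  have "(\<integral>\<^sup>+z. f z \<partial>zz_M) = (\<integral>\<^sup>+x. \<integral>\<^sup>+v. f (x, v) \<partial>count_space {-1, 1} \<partial>lborel)"
    using C.nn_integral_fst[of f lborel] assms by (simp add: zz_M_def)
  also have "\<dots> = (\<integral>\<^sup>+x. f (x, 1) + f (x, -1) \<partial>lborel)"
    by (intro nn_integral_cong) (simp add: nn_integral_count_space_finite add.commute)
  also have "\<dots> = (\<integral>\<^sup>+x. f (x, 1) \<partial>lborel) + (\<integral>\<^sup>+x. f (x, -1) \<partial>lborel)"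
    by (rule nn_integral_add) (use sect in auto)
  finally show ?thesis .
qed

lemma integral_zz_M:
  fixes f :: "real \<times> real \<Rightarrow> real"
  assumes f: "\<And>v. v \<in> {-1, 1} \<Longrightarrow> integrable lborel (\<lambda>x. f (x, v))"
  shows "integrable zz_M f"
    and "(\<integral>z. f z \<partial>zz_M) = (\<integral>x. f (x, 1) \<partial>lborel) + (\<integral>x. f (x, -1) \<partial>lborel)"
proof -
  interpret C: sigma_finite_measure "count_space {-1, 1 :: real}"
    by (rule sigma_finite_measure_count_space_finite) simp
  interpret P: pair_sigma_finite lborel "count_space {-1, 1 :: real}" ..
  have [measurable]: "f \<in> borel_measurable zz_M"
    using f by (intro borel_measurable_zz_M_I) (auto dest!: borel_measurable_integrable)
  have "(\<integral>\<^sup>+z. ennreal (norm (f z)) \<partial>zz_M) < \<infinity>"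
    using f by (subst nn_integral_zz_M) (auto simp: integrable_iff_bounded)
  then show int: "integrable zz_M f"
    by (simp add: integrable_iff_bounded)
  have "(\<integral>z. f z \<partial>zz_M) = (\<integral>x. (\<integral>v. f (x, v) \<partial>count_space {-1, 1}) \<partial>lborel)"
    using P.integral_fst'[of f] int by (simp add: zz_M_def)
  also have "\<dots> = (\<integral>x. f (x, 1) + f (x, -1) \<partial>lborel)"
    by (simp add: lebesgue_integral_count_space_finite add.commute)
  also have "\<dots> = (\<integral>x. f (x, 1) \<partial>lborel) + (\<integral>x. f (x, -1) \<partial>lborel)"
    using f by simp
  finally show "(\<integral>z. f z \<partial>zz_M) = (\<integral>x. f (x, 1) \<partial>lborel) + (\<integral>x. f (x, -1) \<partial>lborel)" .
qed

text \<open>Continuous test functions are the ones for which the differential equations hold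
  classically. Ramps increase to the indicator of \<open>{a<..} \<times> {v}\<close>, and such
  half-lines determine a finite measure on each copy of the line.\<close>

lemma measure_zz_M_eqI:
  assumes sets: "sets N1 = sets zz_M" "sets N2 = sets zz_M"
    and fin: "emeasure N1 (space N1) < \<infinity>"
    and eq: "\<And>g. \<lbrakk>\<And>v. v \<in> {-1, 1} \<Longrightarrow> continuous_on UNIV (\<lambda>x. g (x, v)); \<And>z. 0 \<le> g z; \<And>z. g z \<le> 1\<rbrakk>
       \<Longrightarrow> (\<integral>\<^sup>+z. ennreal (g z) \<partial>N1) = (\<integral>\<^sup>+z. ennreal (g z) \<partial>N2)"
  shows "N1 = N2"
proof -
  have rect: "B \<times> {v} \<in> sets zz_M" if "B \<in> sets borel" "v \<in> {-1, 1}" for B v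
    unfolding zz_M_def by (rule pair_measureI) (use that in auto)
  \<comment> \<open>\<open>m v N\<close> is the part of \<open>N\<close> on the copy with velocity
    \<open>v\<close>, pushed forward to the line.\<close>
  define m where "m v N = distr (density N (indicator (UNIV \<times> {v}))) borel fst" for v :: real and N :: "(real \<times> real) measure"
  have em: "emeasure (m v N) B = emeasure N (B \<times> {v})"
    if s: "sets N = sets zz_M" and B: "B \<in> sets borel" and v: "v \<in> {-1, 1}" for N B v
  proof -
    have fst: "fst \<in> measurable N borel"
      using s by (simp add: zz_M_def cong: measurable_cong_sets)
    have sp: "space N = UNIV \<times> {-1, 1}"
      using sets_eq_imp_space_eq[OF s] by (simp add: space_zz_M zz_E_def)
    have "emeasure (m v N) B = emeasure (density N (indicator (UNIV \<times> {v}))) (fst -` B \<inter> space N)"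
      unfolding m_def using fst B by (subst emeasure_distr) auto
    also have "\<dots> = (\<integral>\<^sup>+z. indicator (UNIV \<times> {v}) z * indicator (fst -` B \<inter> space N) z \<partial>N)"
      by (rule emeasure_density) (use rect[of UNIV v] v s measurable_sets[OF fst B] in auto)
    also have "\<dots> = (\<integral>\<^sup>+z. indicator (B \<times> {v}) z \<partial>N)"
      using v by (intro nn_integral_cong) (auto simp: sp split: split_indicator)
    also have "\<dots> = emeasure N (B \<times> {v})"
      using rect[OF B v] s by simp
    finally show ?thesis .
  qed
  have meq: "m v N1 = m v N2" if v: "v \<in> {-1, 1}" for v
  proof (rule measure_eqI_lessThan)
    show "sets (m v N1) = sets borel" "sets (m v N2) = sets borel"
      by (simp_all add: m_def)
    fix a :: real
    have "emeasure N1 ({a<..} \<times> {v}) \<le> emeasure N1 (space N1)"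
      by (rule emeasure_space)
    then show "emeasure (m v N1) {a<..} < \<infinity>"
      using em[OF sets(1) _ v, of "{a<..}"] fin by (simp add: order_le_less_trans)
    \<comment> \<open>The slope \<open>n\<close> makes the ramp reach 1 at \<open>a + 1 / n\<close>,
      while it stays 0 at \<open>a\<close> itself; the limit is therefore the open
      half-line.\<close>
    define g where "g n = (\<lambda>(x, u). if u = v then min 1 (real n * max 0 (x - a)) else 0)" for n
    have lim: "(\<lambda>n. \<integral>\<^sup>+z. ennreal (g n z) \<partial>N) \<longlonglongrightarrow> emeasure N ({a<..} \<times> {v})"
      if s: "sets N = sets zz_M" for N
    proof -
      have "(\<lambda>n. \<integral>\<^sup>+z. ennreal (g n z) \<partial>N) \<longlonglongrightarrow> (\<integral>\<^sup>+z. indicator ({a<..} \<times> {v}) z \<partial>N)"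
      proof (rule nn_integral_LIMSEQ)
        show "incseq (\<lambda>n z. ennreal (g n z))"
          unfolding incseq_def le_fun_def g_def
          by (intro allI impI ennreal_leI) (auto intro!: min.coboundedI2 mult_right_mono split: prod.splits)
        have "g n \<in> borel_measurable zz_M" for n
          by (rule borel_measurable_zz_M_I) (simp add: g_def)
        then show "(\<lambda>z. ennreal (g n z)) \<in> borel_measurable N" for n
          using s by (simp cong: measurable_cong_sets)
        fix z :: "real \<times> real"
        obtain x u where z: "z = (x, u)" by (cases z)
        show "(\<lambda>n. ennreal (g n z)) \<longlonglongrightarrow> indicator ({a<..} \<times> {v}) z"
        proof (cases "a < x \<and> u = v")
          case True
          obtain n0 where n0: "1 / (x - a) < real n0" using reals_Archimedean2 by blast
          have "\<forall>\<^sub>F n in sequentially. ennreal (g n z) = 1"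
            using eventually_ge_at_top[of n0]
          proof eventually_elim
            case (elim n)
            then have "1 / (x - a) < real n" using n0 by simp
            with True have "1 < real n * (x - a)" by (simp add: field_simps)
            with True show ?case by (simp add: g_def z)
          qed
          with True show ?thesis by (simp add: z tendsto_eventually)
        next
          case False
          then have "g n z = 0" for n by (auto simp: g_def z)
          with False show ?thesis by (auto simp: z)
        qed
      qed
      then show ?thesis using rect[of "{a<..}" v] v s by simp
    qed
    have "(\<integral>\<^sup>+z. ennreal (g n z) \<partial>N1) = (\<integral>\<^sup>+z. ennreal (g n z) \<partial>N2)" for n
    proof (rule eq)
      show "continuous_on UNIV (\<lambda>x. g n (x, u))" for u
        by (cases "u = v") (auto simp: g_def intro!: continuous_intros)
    qed (auto simp: g_def split: prod.splits)
    then have "emeasure N1 ({a<..} \<times> {v}) = emeasure N2 ({a<..} \<times> {v})"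
      using lim[OF sets(1)] lim[OF sets(2)] by (auto intro: LIMSEQ_unique)
    then show "emeasure (m v N1) {a<..} = emeasure (m v N2) {a<..}"
      using em[OF sets(1) _ v] em[OF sets(2) _ v] by simp
  qed
  show ?thesis
  proof (rule measure_eqI)
    show "sets N1 = sets N2" using sets by simp
    fix A assume "A \<in> sets N1"
    then have A: "A \<in> sets zz_M" using sets by simp
    define B where "B v = (\<lambda>x. (x, v)) -` A" for v
    have B: "B v \<in> sets borel" if "v \<in> {-1, 1}" for v
      using measurable_sets[OF measurable_zz_M_Pair[OF that] A] by (simp add: B_def)
    have "A \<subseteq> UNIV \<times> {-1, 1}"
      using sets.sets_into_space[OF A] by (simp add: space_zz_M zz_E_def)
    then have A_eq: "A = B 1 \<times> {1} \<union> B (-1) \<times> {-1}"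
      by (auto simp: B_def)
    have "emeasure N A = emeasure (m 1 N) (B 1) + emeasure (m (-1) N) (B (-1))"
      if s: "sets N = sets zz_M" for N
      unfolding A_eq
      by (subst plus_emeasure[symmetric]) (use s rect[OF B] em[OF s B] in auto)
    with sets meq show "emeasure N1 A = emeasure N2 A" by simp
  qed
qed

section \<open>The target measure\<close>

locale zz_target =
  fixes U U' :: "real \<Rightarrow> real"
  assumes U_deriv: "\<And>x. (U has_real_derivative U' x) (at x)"
    and U'_cont: "continuous_on UNIV U'"
    and exp_int: "integrable lborel (\<lambda>x. exp (- U x))"
    and U'_exp_int: "integrable lborel (\<lambda>x. \<bar>U' x\<bar> * exp (- U x))"
begin

definition Z :: real where "Z = (\<integral>y. exp (- U y) \<partial>lborel)"

lemma U_cont: "continuous_on UNIV U"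
  using U_deriv by (meson DERIV_isCont continuous_at_imp_continuous_on)

lemma U_measurable [measurable]: "U \<in> borel_measurable borel"
  using U_cont by (rule borel_measurable_continuous_onI)

lemma Z_pos: "0 < Z"
proof -
  have "Z \<noteq> 0"
  proof
    assume "Z = 0"
    then have "AE x in lborel. exp (- U x) = 0"
      unfolding Z_def using integral_nonneg_eq_0_iff_AE[OF exp_int] by simp
    then have "AE x::real in lborel. False" by simp
    then have "emeasure lborel (UNIV :: real set) = 0"
      by (simp add: AE_iff_measurable[OF _ refl])
    then show False by simp
  qed
  moreover have "0 \<le> Z" by (simp add: Z_def)
  ultimately show ?thesis by simp
qed

lemma zz_mu_eq: "zz_mu U = density zz_M (\<lambda>z. ennreal (exp (- U (fst z)) / (2 * Z)))"
  unfolding zz_mu_def Z_def by (intro arg_cong2[where f = density] refl) (auto simp: fun_eq_iff)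

lemma U_fst_measurable [measurable]: "(\<lambda>z. U (fst z)) \<in> borel_measurable zz_M"
  by (rule borel_measurable_zz_M_I) simp

lemma sets_zz_mu [simp, measurable_cong]: "sets (zz_mu U) = sets zz_M"
  by (simp add: zz_mu_eq)

lemma space_zz_mu: "space (zz_mu U) = zz_E"
  by (simp add: zz_mu_eq space_zz_M)

text \<open>Both velocities carry the same weight, so an integral over the state space reduces to
  that of the velocity average, that is of the even part, over the line.\<close>

lemma integral_zz_mu:
  fixes f :: "real \<times> real \<Rightarrow> real"
  assumes f: "\<And>v. v \<in> {-1, 1} \<Longrightarrow> (\<lambda>x. f (x, v)) \<in> borel_measurable borel"
    and int: "\<And>v. v \<in> {-1, 1} \<Longrightarrow> integrable lborel (\<lambda>x. exp (- U x) * f (x, v))"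
  shows "integrable (zz_mu U) f"
    and "(\<integral>z. f z \<partial>zz_mu U) = (\<integral>x. exp (- U x) * ((f (x, 1) + f (x, -1)) / 2) \<partial>lborel) / Z"
proof -
  have [measurable]: "f \<in> borel_measurable zz_M"
    using f by (rule borel_measurable_zz_M_I)
  have i: "integrable lborel (\<lambda>x. (exp (- U (fst (x, v))) / (2 * Z)) *\<^sub>R f (x, v))" if "v \<in> {-1, 1}" for v
    using int[OF that] by simp
  show "integrable (zz_mu U) f"
    unfolding zz_mu_eq
    by (subst integrable_density) (use integral_zz_M(1)[OF i] Z_pos in \<open>auto simp: less_imp_le\<close>)
  have "(\<integral>z. f z \<partial>zz_mu U) = (\<integral>z. (exp (- U (fst z)) / (2 * Z)) *\<^sub>R f z \<partial>zz_M)"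
    unfolding zz_mu_eq by (subst integral_density) (use Z_pos in \<open>auto simp: less_imp_le\<close>)
  also have "\<dots> = (\<integral>x. exp (- U x) * f (x, 1) / (2 * Z) \<partial>lborel) + (\<integral>x. exp (- U x) * f (x, -1) / (2 * Z) \<partial>lborel)"
    by (subst integral_zz_M(2)) (use i in auto)
  also have "\<dots> = (\<integral>x. exp (- U x) * f (x, 1) / (2 * Z) + exp (- U x) * f (x, -1) / (2 * Z) \<partial>lborel)"
    using int by simp
  also have "\<dots> = (\<integral>x. exp (- U x) * ((f (x, 1) + f (x, -1)) / 2) / Z \<partial>lborel)"
    by (intro Bochner_Integration.integral_cong) (auto simp: distrib_left add_divide_distrib mult.commute[of 2])
  also have "\<dots> = (\<integral>x. exp (- U x) * ((f (x, 1) + f (x, -1)) / 2) \<partial>lborel) / Z"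
    by simp
  finally show "(\<integral>z. f z \<partial>zz_mu U) = (\<integral>x. exp (- U x) * ((f (x, 1) + f (x, -1)) / 2) \<partial>lborel) / Z" .
qed

text \<open>Affine growth in \<open>\<bar>U' x\<bar>\<close> is the growth allowed to the
  intensities, and the two integrability assumptions of the locale cover it. The case
  \<open>b = 0\<close> handles bounded functions.\<close>

lemma exp_mult_integrable:
  assumes q: "\<And>x. \<bar>q x\<bar> \<le> a + b * \<bar>U' x\<bar>" and [measurable]: "q \<in> borel_measurable borel"
  shows "integrable lborel (\<lambda>x. exp (- U x) * q x)"
proof (rule Bochner_Integration.integrable_bound)
  show "integrable lborel (\<lambda>x. a * exp (- U x) + b * (\<bar>U' x\<bar> * exp (- U x)))"
    using exp_int U'_exp_int by simp
  show "AE x in lborel. norm (exp (- U x) * q x) \<le> norm (a * exp (- U x) + b * (\<bar>U' x\<bar> * exp (- U x)))"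
  proof (intro AE_I2)
    fix x
    have "exp (- U x) * \<bar>q x\<bar> \<le> exp (- U x) * (a + b * \<bar>U' x\<bar>)"
      by (intro mult_left_mono q) simp
    also have "\<dots> = a * exp (- U x) + b * (\<bar>U' x\<bar> * exp (- U x))"
      by (simp add: algebra_simps)
    finally show "norm (exp (- U x) * q x) \<le> norm (a * exp (- U x) + b * (\<bar>U' x\<bar> * exp (- U x)))"
      by (simp add: abs_mult)
  qed
qed simp

lemma prob_space_zz_mu: "prob_space (zz_mu U)"
proof
  have "(\<integral>\<^sup>+x. ennreal (exp (- U x) / (2 * Z)) \<partial>lborel) = ennreal (1 / 2)"
    using exp_int Z_pos by (subst nn_integral_eq_integral) (auto simp: Z_def less_imp_le)
  note half = this
  have "emeasure (zz_mu U) (space (zz_mu U)) = (\<integral>\<^sup>+z. ennreal (exp (- U (fst z)) / (2 * Z)) \<partial>zz_M)"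
    unfolding zz_mu_eq space_density by (subst emeasure_density) (auto intro!: nn_integral_cong)
  also have "\<dots> = 1"
  proof (subst nn_integral_zz_M)
    have "ennreal (1 / 2) + ennreal (1 / 2) = 1"
      by (subst ennreal_plus[symmetric]) auto
    then show "(\<integral>\<^sup>+x. ennreal (exp (- U (fst (x, 1 :: real))) / (2 * Z)) \<partial>lborel)
        + (\<integral>\<^sup>+x. ennreal (exp (- U (fst (x, -1 :: real))) / (2 * Z)) \<partial>lborel) = 1"
      by (simp only: fst_conv half)
  qed simp
  finally show "emeasure (zz_mu U) (space (zz_mu U)) = 1" .
qed

end

section \<open>Regularity of the resolvent and the equations for its even and odd parts\<close>

context zigzag
begin

lemma jump_source_measurable:
  assumes "g \<in> borel_measurable zz_M" and v: "v \<in> {-1, 1}"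
  shows "(\<lambda>x. jump_source g (x, v)) \<in> borel_measurable borel"
proof -
  have [measurable]: "(\<lambda>x. resolvent g (x, u)) \<in> borel_measurable borel" if "u \<in> {-1, 1}" for u
    using measurable_compose[OF measurable_zz_M_Pair[OF that] resolvent_measurable[OF assms(1)]] .
  have [measurable]: "(\<lambda>x. g (x, v)) \<in> borel_measurable borel"
    using measurable_compose[OF measurable_zz_M_Pair[OF v] assms(1)] .
  have "- v \<in> {-1, 1}" using v by auto
  then show ?thesis
    unfolding jump_source_def using v by simp
qed

text \<open>Every resolvent value is at most \<open>M / l\<close>, and \<open>M = M / l * l\<close>;
  the three terms thus add up to a multiple of the total loss rate, as \<open>flow_integral\<close>
  demands.\<close>

lemma jump_source_bound:
  assumes g: "g \<in> borel_measurable zz_M" "\<And>z. \<bar>g z\<bar> \<le> M" and v: "v \<in> {-1, 1}"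
  shows "\<bar>jump_source g (x, v)\<bar> \<le> M / l * (l + lbar + lam (x, v))"
proof -
  have E: "(x, 1) \<in> zz_E" "(x, -1) \<in> zz_E" "(x, v) \<in> zz_E" "(x, -v) \<in> zz_E"
    using v by (auto simp: zz_E_def)
  note bds = resolvent_bound[OF g E(1)] resolvent_bound[OF g E(2)] resolvent_bound[OF g E(4)]
  have avg: "\<bar>1/2 * resolvent g (x, 1) + 1/2 * resolvent g (x, -1)\<bar> \<le> M / l"
    using bds by linarith
  have "\<bar>jump_source g (x, v)\<bar> \<le> \<bar>g (x, v)\<bar> + \<bar>lam (x, v) * resolvent g (x, - v)\<bar>
     + \<bar>lbar * (1/2 * resolvent g (x, 1) + 1/2 * resolvent g (x, -1))\<bar>"
    unfolding jump_source_def prod.case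
    by (intro order_trans[OF abs_triangle_ineq] add_mono abs_triangle_ineq order_refl)
  also have "\<dots> \<le> M + lam (x, v) * (M / l) + lbar * (M / l)"
    unfolding abs_mult abs_of_nonneg[OF lam_nonneg[OF E(3)]] abs_of_nonneg[OF lbar_nonneg]
    by (intro add_mono mult_left_mono avg lam_nonneg E lbar_nonneg g bds)
  also have "\<dots> = M / l * (l + lbar + lam (x, v))"
    using l_pos by (simp add: field_simps)
  finally show ?thesis .
qed

text \<open>A primitive \<open>A\<close> exists because the rate is continuous. The source still
  contains the resolvent, so only its measurability and its bound enter.\<close>

lemma flow_integral_resolvent:
  assumes v: "v \<in> {-1, 1}" and g: "g \<in> borel_measurable zz_M" "\<And>z. \<bar>g z\<bar> \<le> M"
  shows "\<exists>A. flow_integral A (\<lambda>y. l + lbar + lam (v * y, v)) (\<lambda>y. jump_source g (v * y, v))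
     (\<lambda>y. resolvent g (v * y, v)) l (M / l)"
proof -
  have k_cont: "continuous_on UNIV (\<lambda>y. l + lbar + lam (v * y, v))"
    by (intro continuous_intros continuous_on_compose2[OF lam_cont[OF v]]) auto
  then obtain A where A: "\<And>y. (A has_real_derivative l + lbar + lam (v * y, v)) (at y)"
    using einterval_antiderivative[of "-\<infinity>" "\<infinity>" "\<lambda>y. l + lbar + lam (v * y, v)"]
    by (auto simp: continuous_on_eq_continuous_at has_real_derivative_iff_has_vector_derivative)
  have "(x, v) \<in> zz_E" for x using v by (simp add: zz_E_def)
  then have "l \<le> l + lbar + lam (v * y, v)" for y
    using lam_nonneg lbar_nonneg by simp
  moreover have "(\<lambda>y. jump_source g (v * y, v)) \<in> borel_measurable borel"
    using measurable_compose[OF _ jump_source_measurable[OF g(1) v], of "\<lambda>y. v * y" borel] by simp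
  ultimately have "flow_integral A (\<lambda>y. l + lbar + lam (v * y, v)) (\<lambda>y. jump_source g (v * y, v))
     (\<lambda>y. resolvent g (v * y, v)) l (M / l)"
    by unfold_locales (use A k_cont l_pos jump_source_bound[OF g v] resolvent_equation[OF v g A] in auto)
  then show ?thesis by blast
qed

text \<open>First bootstrap stage, valid for measurable \<open>g\<close>. The parametrisation
  \<open>x = v * y\<close> is undone by \<open>v * v = 1\<close>.\<close>

lemma resolvent_continuous:
  assumes v: "v \<in> {-1, 1}" and g: "g \<in> borel_measurable zz_M" "\<And>z. \<bar>g z\<bar> \<le> M"
  shows "continuous_on UNIV (\<lambda>x. resolvent g (x, v))"
proof -
  obtain A where "flow_integral A (\<lambda>y. l + lbar + lam (v * y, v)) (\<lambda>y. jump_source g (v * y, v))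
     (\<lambda>y. resolvent g (v * y, v)) l (M / l)"
    using flow_integral_resolvent[OF assms] by blast
  then have "continuous_on UNIV (\<lambda>y. resolvent g (v * y, v))"
    by (simp add: continuous_on_eq_continuous_at flow_integral.isCont_w)
  then have "continuous_on UNIV (\<lambda>x. resolvent g (v * (v * x), v))"
    by (rule continuous_on_compose2) (auto intro!: continuous_intros)
  moreover have "v * (v * x) = x" for x using v by auto
  ultimately show ?thesis by simp
qed

text \<open>Continuity of the resolvent makes the source continuous, so the flow equation holds
  classically; the factor \<open>v\<close> comes from the change of variable
  \<open>x = v * y\<close>.\<close>

lemma resolvent_deriv:
  assumes v: "v \<in> {-1, 1}" and g: "g \<in> borel_measurable zz_M" "\<And>z. \<bar>g z\<bar> \<le> M"
    and g_cont: "\<And>v. v \<in> {-1, 1} \<Longrightarrow> continuous_on UNIV (\<lambda>x. g (x, v))"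
  shows "((\<lambda>x. resolvent g (x, v)) has_real_derivative
     v * ((l + lbar + lam (x, v)) * resolvent g (x, v) - jump_source g (x, v))) (at x)"
proof -
  have vv: "v * (v * x) = x" for x using v by auto
  have "- v \<in> {-1, 1}" using v by auto
  then have js: "continuous_on UNIV (\<lambda>x. jump_source g (x, v))"
    unfolding jump_source_def prod.case
    by (intro continuous_intros resolvent_continuous[OF _ g] g_cont lam_cont v) auto
  have js': "continuous_on UNIV (\<lambda>y. jump_source g (v * y, v))"
    by (rule continuous_on_compose2[OF js]) (auto intro!: continuous_intros)
  obtain A where "flow_integral A (\<lambda>y. l + lbar + lam (v * y, v)) (\<lambda>y. jump_source g (v * y, v))
     (\<lambda>y. resolvent g (v * y, v)) l (M / l)"
    using flow_integral_resolvent[OF v g] by blast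
  from flow_integral.w_deriv[OF this js', of "v * x"]
  have "((\<lambda>y. resolvent g (v * y, v)) has_real_derivative
     (l + lbar + lam (x, v)) * resolvent g (x, v) - jump_source g (x, v)) (at (v * x))"
    by (simp add: vv)
  then have "((\<lambda>x. resolvent g (v * (v * x), v)) has_real_derivative
     ((l + lbar + lam (x, v)) * resolvent g (x, v) - jump_source g (x, v)) * v) (at x)"
    by (rule DERIV_chain2) (auto intro!: derivative_eq_intros)
  then show ?thesis by (simp only: vv mult.commute[of _ v])
qed

text \<open>\<open>even_part\<close> and \<open>odd_part\<close> are the \<open>a\<close> and
  \<open>b\<close> of the overview, and \<open>total_rate\<close> is its
  \<open>kappa\<close>.\<close>

definition even_part :: "(real \<times> real \<Rightarrow> real) \<Rightarrow> real \<Rightarrow> real" where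
  "even_part g x = (resolvent g (x, 1) + resolvent g (x, -1)) / 2"

definition odd_part :: "(real \<times> real \<Rightarrow> real) \<Rightarrow> real \<Rightarrow> real" where
  "odd_part g x = (resolvent g (x, 1) - resolvent g (x, -1)) / 2"

definition total_rate :: "real \<Rightarrow> real" where
  "total_rate x = l + lbar + lam (x, 1) + lam (x, -1)"

lemma total_rate_cont: "continuous_on UNIV total_rate"
  unfolding total_rate_def by (intro continuous_intros lam_cont) auto

lemma total_rate_nonneg: "0 \<le> total_rate x"
  unfolding total_rate_def using l_pos lbar_nonneg lam_nonneg[of "(x, 1)"] lam_nonneg[of "(x, -1)"]
  by (simp add: zz_E_def)

lemma parts_cont:
  assumes g: "g \<in> borel_measurable zz_M" "\<And>z. \<bar>g z\<bar> \<le> M"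
  shows "continuous_on UNIV (even_part g)" "continuous_on UNIV (odd_part g)"
  unfolding even_part_def odd_part_def
  by (intro continuous_intros resolvent_continuous[OF _ g]; simp)+

lemma parts_bound:
  assumes g: "g \<in> borel_measurable zz_M" "\<And>z. \<bar>g z\<bar> \<le> M"
  shows "\<bar>even_part g x\<bar> \<le> M / l" "\<bar>odd_part g x\<bar> \<le> M / l"
proof -
  have "\<bar>resolvent g (x, 1)\<bar> \<le> M / l" "\<bar>resolvent g (x, -1)\<bar> \<le> M / l"
    by (auto intro!: resolvent_bound[OF g] simp: zz_E_def)
  then show "\<bar>even_part g x\<bar> \<le> M / l" "\<bar>odd_part g x\<bar> \<le> M / l"
    unfolding even_part_def odd_part_def by - (rule abs_leI; argo)+
qed

text \<open>Half the sum of the equations for both velocities: their opposite signs cancel the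
  refreshment gains, and all loss rates add up on the odd part.\<close>

lemma even_part_deriv:
  assumes g: "g \<in> borel_measurable zz_M" "\<And>z. \<bar>g z\<bar> \<le> M"
    and g_cont: "\<And>v. v \<in> {-1, 1} \<Longrightarrow> continuous_on UNIV (\<lambda>x. g (x, v))"
  shows "(even_part g has_real_derivative
    total_rate x * odd_part g x - (g (x, 1) - g (x, -1)) / 2) (at x)"
  unfolding even_part_def[abs_def]
  by (rule derivative_eq_intros resolvent_deriv[OF _ g g_cont] refl | simp)+
     (simp add: jump_source_def total_rate_def odd_part_def field_simps)

text \<open>Half the difference: gain and loss by refreshment cancel, so the intensities enter only
  through \<open>lam (x, 1) - lam (x, -1)\<close>, which is the same for both processes to be
  compared.\<close>

lemma odd_part_deriv:
  assumes g: "g \<in> borel_measurable zz_M" "\<And>z. \<bar>g z\<bar> \<le> M"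
    and g_cont: "\<And>v. v \<in> {-1, 1} \<Longrightarrow> continuous_on UNIV (\<lambda>x. g (x, v))"
  shows "(odd_part g has_real_derivative
    (lam (x, 1) - lam (x, -1)) * odd_part g x + l * even_part g x - (g (x, 1) + g (x, -1)) / 2) (at x)"
  unfolding odd_part_def[abs_def]
  by (rule derivative_eq_intros resolvent_deriv[OF _ g g_cont] refl | simp)+
     (simp add: jump_source_def even_part_def odd_part_def field_simps)

end

subsection \<open>Invariance of the target measure\<close>

context zigzag
begin

text \<open>Mixing over an exponential time turns \<open>l * resolvent\<close> into averaging
  against a probability kernel, so that invariance becomes an identity of measures.\<close>

definition exp_time :: "real measure" where
  "exp_time = density lborel (\<lambda>t. ennreal (indicator {0..} t * (l * exp (- l * t))))"

lemma prob_space_exp_time: "prob_space exp_time"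
proof
  have "has_bochner_integral lborel (\<lambda>t. l * (indicator {0..} t * exp (- l * t))) (l * (1 / l))"
    by (intro has_bochner_integral_mult_right has_bochner_integral_exp_atLeast l_pos)
  then have hb: "has_bochner_integral lborel (\<lambda>t. indicator {0..} t * (l * exp (- l * t))) 1"
    using l_pos by (simp add: mult.left_commute)
  then have "(\<integral>\<^sup>+t. ennreal (indicator {0..} t * (l * exp (- l * t))) \<partial>lborel) = ennreal 1"
    using l_pos by (subst nn_integral_eq_integral) (auto simp: has_bochner_integral_iff)
  then show "emeasure exp_time (space exp_time) = 1"
    unfolding exp_time_def space_density by (subst emeasure_density) auto
qed

text \<open>The law of the state at an independent exponential time of rate \<open>l\<close>, tested against \<open>f\<close>.\<close>

definition exp_avg :: "(real \<times> real \<Rightarrow> ennreal) \<Rightarrow> real \<times> real \<Rightarrow> ennreal" where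
  "exp_avg f z = (\<integral>\<^sup>+t. ennreal (indicator {0..} t * (l * exp (- l * t))) * (\<integral>\<^sup>+w. f w \<partial>K (max 0 t) z) \<partial>lborel)"

lemma K_swap_measurable: "(\<lambda>(z, t). K (max 0 t) z) \<in> zz_M \<Otimes>\<^sub>M borel \<rightarrow>\<^sub>M subprob_algebra zz_M"
  using measurable_compose[OF measurable_pair_swap' measurable_prob_algebraD[OF K_measurable]]
  by (simp add: case_prod_beta')

lemma nn_semigroup_measurable:
  fixes f :: "real \<times> real \<Rightarrow> ennreal"
  assumes "f \<in> borel_measurable zz_M"
  shows "(\<lambda>(z, t). \<integral>\<^sup>+w. f w \<partial>K (max 0 t) z) \<in> borel_measurable (zz_M \<Otimes>\<^sub>M borel)"
  using measurable_compose[OF K_swap_measurable nn_integral_measurable_subprob_algebra[OF assms]]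
  by (simp add: case_prod_beta')

lemma nn_semigroup_section_measurable:
  fixes f :: "real \<times> real \<Rightarrow> ennreal"
  assumes "f \<in> borel_measurable zz_M" "z \<in> zz_E"
  shows "(\<lambda>t. \<integral>\<^sup>+w. f w \<partial>K (max 0 t) z) \<in> borel_measurable borel"
proof -
  have "(\<lambda>t. (z, t)) \<in> borel \<rightarrow>\<^sub>M zz_M \<Otimes>\<^sub>M borel"
    using assms(2) by (simp add: space_zz_M)
  from measurable_compose[OF this nn_semigroup_measurable[OF assms(1)]] show ?thesis
    by simp
qed

lemma exp_avg_measurable [measurable]:
  assumes "f \<in> borel_measurable zz_M"
  shows "exp_avg f \<in> borel_measurable zz_M"
proof -
  have [measurable]: "(\<lambda>p. \<integral>\<^sup>+w. f w \<partial>K (max 0 (snd p)) (fst p)) \<in> borel_measurable (zz_M \<Otimes>\<^sub>M lborel)"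
    using nn_semigroup_measurable[OF assms] by (simp add: case_prod_beta' cong: measurable_cong_sets)
  show ?thesis
    unfolding exp_avg_def by (rule lborel.borel_measurable_nn_integral) (simp add: case_prod_beta')
qed

lemma exp_avg_eq_resolvent:
  assumes g: "g \<in> borel_measurable zz_M" "\<And>z. 0 \<le> g z" "\<And>z. g z \<le> M" and z: "z \<in> zz_E"
  shows "exp_avg (\<lambda>w. ennreal (g w)) z = ennreal (l * resolvent g z)"
proof -
  have g': "\<bar>g z\<bar> \<le> M" for z using g by simp
  have P: "(\<integral>\<^sup>+w. ennreal (g w) \<partial>K (max 0 t) z) = ennreal (zz_semigroup K (max 0 t) g z)" for t
  proof -
    interpret prob_space "K (max 0 t) z" by (rule K_prob_space) (use z in auto)
    have [measurable]: "g \<in> borel_measurable (K (max 0 t) z)"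
      using g(1) K_prob_space(2)[of "max 0 t" z] z by (simp cong: measurable_cong_sets)
    have "integrable (K (max 0 t) z) g"
      by (rule integrable_const_bound[where B = M]) (use g' in auto)
    then show ?thesis
      unfolding zz_semigroup_def using g(2) by (subst nn_integral_eq_integral) auto
  qed
  have P_nonneg: "0 \<le> zz_semigroup K t g z" for t
    unfolding zz_semigroup_def using g(2) by simp
  have "exp_avg (\<lambda>w. ennreal (g w)) z
     = (\<integral>\<^sup>+t. ennreal (l * (indicator {0..} t * exp (- l * t) * zz_semigroup K (max 0 t) g z)) \<partial>lborel)"
    unfolding exp_avg_def P using l_pos P_nonneg
    by (intro nn_integral_cong) (auto simp: mult_ac simp flip: ennreal_mult split: split_indicator)
  also have "\<dots> = ennreal (\<integral>t. l * (indicator {0..} t * exp (- l * t) * zz_semigroup K (max 0 t) g z) \<partial>lborel)"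
    using exp_semigroup_integrable[OF g(1) g' z] l_pos P_nonneg
    by (intro nn_integral_eq_integral) auto
  also have "\<dots> = ennreal (l * resolvent g z)"
    unfolding resolvent_eq_max by simp
  finally show ?thesis .
qed

end

text \<open>\<open>lam_diff\<close> is the balance condition behind invariance of
  \<open>zz_mu U\<close>; a summand of the intensity that is even in \<open>v\<close> cancels in it.
  \<open>lam_le\<close> makes the rates integrable against the target.\<close>

locale zigzag_stationary = zigzag lam lbar l K + zz_target U U'
  for lam lbar l K U U' +
  fixes c C :: real
  assumes lam_diff: "\<And>x. lam (x, 1) - lam (x, -1) = U' x"
    and lam_le: "\<And>x v. v \<in> {-1, 1} \<Longrightarrow> lam (x, v) \<le> c + C * \<bar>U' x\<bar>"
begin

lemma total_rate_le: "total_rate x \<le> (l + lbar + 2 * c) + 2 * C * \<bar>U' x\<bar>"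
  using lam_le[of 1 x] lam_le[of "-1" x] by (simp add: total_rate_def)

lemma resolvent_section_measurable:
  assumes "g \<in> borel_measurable zz_M" "v \<in> {-1, 1}"
  shows "(\<lambda>x. resolvent g (x, v)) \<in> borel_measurable borel"
  using measurable_compose[OF measurable_zz_M_Pair[OF assms(2)] resolvent_measurable[OF assms(1)]] .

text \<open>In the derivative of \<open>exp (- U x) * odd_part g x\<close> the \<open>U'\<close>
  terms cancel by \<open>lam_diff\<close>; what remains is \<open>l\<close> times the even part
  minus the velocity average of \<open>g\<close>, and it integrates to 0.\<close>

lemma integral_resolvent:
  assumes g_cont: "\<And>v. v \<in> {-1, 1} \<Longrightarrow> continuous_on UNIV (\<lambda>x. g (x, v))" and g_le: "\<And>z. \<bar>g z\<bar> \<le> M"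
  shows "integrable (zz_mu U) g" "integrable (zz_mu U) (resolvent g)"
    and "l * (\<integral>z. resolvent g z \<partial>zz_mu U) = (\<integral>z. g z \<partial>zz_mu U)"
proof -
  have g_sect: "(\<lambda>x. g (x, v)) \<in> borel_measurable borel" if "v \<in> {-1, 1}" for v
    using g_cont[OF that] by (rule borel_measurable_continuous_onI)
  then have g_meas: "g \<in> borel_measurable zz_M"
    by (rule borel_measurable_zz_M_I)
  note g = g_meas g_le
  have int_g: "integrable lborel (\<lambda>x. exp (- U x) * g (x, v))" if "v \<in> {-1, 1}" for v
    by (rule exp_mult_integrable[where a = M and b = 0]) (use g_le g_sect that in auto)
  have int_r: "integrable lborel (\<lambda>x. exp (- U x) * resolvent g (x, v))" if "v \<in> {-1, 1}" for v
    by (rule exp_mult_integrable[where a = "M / l" and b = 0])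
       (use resolvent_bound[OF g] resolvent_section_measurable[OF g_meas] that in \<open>auto simp: zz_E_def\<close>)
  show "integrable (zz_mu U) g" "integrable (zz_mu U) (resolvent g)"
    by (rule integral_zz_mu(1); use int_g int_r g_sect resolvent_section_measurable[OF g_meas] in blast)+
  let ?F = "\<lambda>x. exp (- U x) * odd_part g x"
  let ?F' = "\<lambda>x. l * (exp (- U x) * even_part g x) - exp (- U x) * ((g (x, 1) + g (x, -1)) / 2)"
  have even_meas [measurable]: "even_part g \<in> borel_measurable borel" "odd_part g \<in> borel_measurable borel"
    using parts_cont[OF g] by (auto intro: borel_measurable_continuous_onI)
  have int_even: "integrable lborel (\<lambda>x. exp (- U x) * even_part g x)"
    by (rule exp_mult_integrable[where a = "M / l" and b = 0]) (use parts_bound[OF g] in auto)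
  have int_odd: "integrable lborel ?F"
    by (rule exp_mult_integrable[where a = "M / l" and b = 0]) (use parts_bound[OF g] in auto)
  have int_g2: "integrable lborel (\<lambda>x. exp (- U x) * ((g (x, 1) + g (x, -1)) / 2))"
    using int_g[of 1] int_g[of "-1"] by (simp add: distrib_left add_divide_distrib)
  have "(\<integral>x. ?F' x \<partial>lborel) = 0"
  proof (rule integral_deriv_eq_0)
    show "(?F has_real_derivative ?F' x) (at x)" for x
      by (rule derivative_eq_intros U_deriv odd_part_deriv[OF g g_cont] refl | simp)+
         (simp add: lam_diff algebra_simps)
    show "continuous_on UNIV ?F'"
      by (intro continuous_intros U_cont parts_cont[OF g] g_cont) auto
  qed (use int_even int_odd int_g2 in auto)
  then have "l * (\<integral>x. exp (- U x) * even_part g x \<partial>lborel)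
      = (\<integral>x. exp (- U x) * ((g (x, 1) + g (x, -1)) / 2) \<partial>lborel)"
    using int_even int_g2 by simp
  moreover have "(\<integral>z. resolvent g z \<partial>zz_mu U) = (\<integral>x. exp (- U x) * even_part g x \<partial>lborel) / Z"
    unfolding even_part_def using int_r resolvent_section_measurable[OF g_meas] by (rule integral_zz_mu(2)[rotated])
  moreover have "(\<integral>z. g z \<partial>zz_mu U) = (\<integral>x. exp (- U x) * ((g (x, 1) + g (x, -1)) / 2) \<partial>lborel) / Z"
    using int_g g_sect by (rule integral_zz_mu(2)[rotated])
  ultimately show "l * (\<integral>z. resolvent g z \<partial>zz_mu U) = (\<integral>z. g z \<partial>zz_mu U)"
    by (simp only: times_divide_eq_right)
qed

text \<open>\<open>nu\<close> is the law at an independent exponential time of the process started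
  in the target. Continuous test functions identify it with the target, which yields the claim for
  every nonnegative measurable \<open>f\<close>. Invariance at this random time is all that the
  limit arguments use.\<close>

lemma nn_integral_exp_avg:
  assumes f: "f \<in> borel_measurable zz_M"
  shows "(\<integral>\<^sup>+z. exp_avg f z \<partial>zz_mu U) = (\<integral>\<^sup>+z. f z \<partial>zz_mu U)"
proof -
  interpret T: prob_space exp_time by (rule prob_space_exp_time)
  interpret mu: prob_space "zz_mu U" by (rule prob_space_zz_mu)
  interpret P: pair_prob_space "zz_mu U" exp_time ..
  let ?N = "\<lambda>(z, t). K (max 0 t) z"
  define nu where "nu = (zz_mu U \<Otimes>\<^sub>M exp_time) \<bind> ?N"
  have [measurable_cong]: "sets exp_time = sets borel"
    by (simp add: exp_time_def)
  have N: "?N \<in> zz_mu U \<Otimes>\<^sub>M exp_time \<rightarrow>\<^sub>M subprob_algebra zz_M"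
    using K_swap_measurable by (simp cong: measurable_cong_sets)
  have nu_int: "(\<integral>\<^sup>+z. h z \<partial>nu) = (\<integral>\<^sup>+z. exp_avg h z \<partial>zz_mu U)" if h: "h \<in> borel_measurable zz_M" for h
  proof -
    have m [measurable]: "(\<lambda>p. \<integral>\<^sup>+w. h w \<partial>K (max 0 (snd p)) (fst p)) \<in> borel_measurable (zz_mu U \<Otimes>\<^sub>M exp_time)"
      using nn_semigroup_measurable[OF h] by (simp add: case_prod_beta' cong: measurable_cong_sets)
    have "(\<integral>\<^sup>+z. h z \<partial>nu) = (\<integral>\<^sup>+p. \<integral>\<^sup>+w. h w \<partial>K (max 0 (snd p)) (fst p) \<partial>(zz_mu U \<Otimes>\<^sub>M exp_time))"
      unfolding nu_def by (subst nn_integral_bind[OF h N]) (simp add: case_prod_beta')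
    also have "\<dots> = (\<integral>\<^sup>+z. \<integral>\<^sup>+t. \<integral>\<^sup>+w. h w \<partial>K (max 0 t) z \<partial>exp_time \<partial>zz_mu U)"
      by (subst T.nn_integral_fst[symmetric]) simp_all
    also have "\<dots> = (\<integral>\<^sup>+z. exp_avg h z \<partial>zz_mu U)"
      unfolding exp_time_def exp_avg_def
      by (intro nn_integral_cong nn_integral_density)
         (auto intro: nn_semigroup_section_measurable[OF h] simp: space_zz_mu)
    finally show ?thesis .
  qed
  have "nu = zz_mu U"
  proof (rule measure_zz_M_eqI)
    show sets_nu: "sets nu = sets zz_M"
      unfolding nu_def by (rule sets_bind_measurable[OF N P.not_empty])
    show "sets (zz_mu U) = sets zz_M" by simp
    have "emeasure nu (space nu) \<le> 1"
      unfolding nu_def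
      by (intro subprob_space.subprob_emeasure_le_1 subprob_space_bind[OF _ N] P.prob_space_axioms
          prob_space_imp_subprob_space)
    then show "emeasure nu (space nu) < \<infinity>"
      by (simp add: order_le_less_trans[of _ 1])
    fix g :: "real \<times> real \<Rightarrow> real"
    assume g: "\<And>v. v \<in> {-1, 1} \<Longrightarrow> continuous_on UNIV (\<lambda>x. g (x, v))" "\<And>z. 0 \<le> g z" "\<And>z. g z \<le> 1"
    have g': "\<bar>g z\<bar> \<le> 1" for z using g by simp
    have g_meas [measurable]: "g \<in> borel_measurable zz_M"
      by (rule borel_measurable_zz_M_I) (rule borel_measurable_continuous_onI[OF g(1)])
    have R_nonneg: "0 \<le> resolvent g z" for z
      unfolding resolvent_def set_lebesgue_integral_def zz_semigroup_def
      using g(2) by (intro Bochner_Integration.integral_nonneg) auto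
    have "(\<integral>\<^sup>+z. ennreal (g z) \<partial>nu) = (\<integral>\<^sup>+z. exp_avg (\<lambda>w. ennreal (g w)) z \<partial>zz_mu U)"
      by (rule nu_int) simp
    also have "\<dots> = (\<integral>\<^sup>+z. ennreal (l * resolvent g z) \<partial>zz_mu U)"
      by (intro nn_integral_cong exp_avg_eq_resolvent[OF g_meas g(2,3)]) (simp add: space_zz_mu)
    also have "\<dots> = ennreal (\<integral>z. l * resolvent g z \<partial>zz_mu U)"
      using integral_resolvent(2)[OF g(1) g'] R_nonneg l_pos by (intro nn_integral_eq_integral) auto
    also have "\<dots> = ennreal (\<integral>z. g z \<partial>zz_mu U)"
      using integral_resolvent(3)[OF g(1) g'] by simp
    also have "\<dots> = (\<integral>\<^sup>+z. ennreal (g z) \<partial>zz_mu U)"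
      using integral_resolvent(1)[OF g(1) g'] g(2) by (intro nn_integral_eq_integral[symmetric]) auto
    finally show "(\<integral>\<^sup>+z. ennreal (g z) \<partial>nu) = (\<integral>\<^sup>+z. ennreal (g z) \<partial>zz_mu U)" .
  qed
  with nu_int[OF f] show ?thesis by simp
qed

end

subsection \<open>Comparison of the variances\<close>

context zigzag_stationary
begin

lemma zz_var_eq_resolvent: "zz_var mu K l f = 2 * (\<integral>z. f z * resolvent f z \<partial>mu)"
  by (simp add: zz_var_def resolvent_def)

text \<open>Cauchy--Schwarz is avoided: \<open>\<bar>f\<^sub>n(z) f\<^sub>n(w)\<bar> \<le> (h(z)\<^sup>2 + h(w)\<^sup>2) / 2\<close>, and by invariance the right-hand
  side is integrable for the joint law of the stationary state and the state at an
  exponential time.\<close>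

lemma zz_var_tendsto:
  assumes fn [measurable]: "\<And>n. fn n \<in> borel_measurable zz_M" and f [measurable]: "f \<in> borel_measurable zz_M"
    and h [measurable]: "h \<in> borel_measurable zz_M"
    and le: "\<And>n z. \<bar>fn n z\<bar> \<le> h z" and h2: "integrable (zz_mu U) (\<lambda>z. (h z)\<^sup>2)"
    and lim: "AE z in zz_mu U. (\<lambda>n. fn n z) \<longlonglongrightarrow> f z"
  shows "(\<lambda>n. zz_var (zz_mu U) K l (fn n)) \<longlonglongrightarrow> zz_var (zz_mu U) K l f"
proof -
  define H where "H = exp_avg (\<lambda>w. ennreal ((h w)\<^sup>2))"
  define B where "B = {z \<in> space zz_M. \<not> (\<lambda>n. fn n z) \<longlonglongrightarrow> f z}"
  have B_sets [measurable]: "B \<in> sets zz_M"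
    unfolding B_def by measurable
  have H_meas [measurable]: "H \<in> borel_measurable zz_M"
    unfolding H_def by measurable
  have H_int: "(\<integral>\<^sup>+z. H z \<partial>zz_mu U) < \<infinity>"
    unfolding H_def using h2 by (subst nn_integral_exp_avg) (auto simp: integrable_iff_bounded)
  then have H_fin: "AE z in zz_mu U. H z \<noteq> \<infinity>"
    by (intro nn_integral_noteq_infinite) auto
  \<comment> \<open>Invariance transports null sets: from almost every starting point, the set
    \<open>B\<close> where convergence fails is null for the law at the exponential time.\<close>
  have "AE z in zz_mu U. z \<notin> B"
    using lim by eventually_elim (simp add: B_def)
  then have "(\<integral>\<^sup>+z. indicator B z \<partial>zz_mu U) = 0"
    by (subst nn_integral_0_iff_AE) (auto elim!: eventually_mono simp: indicator_def)
  then have "(\<integral>\<^sup>+z. exp_avg (indicator B) z \<partial>zz_mu U) = 0"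
    by (subst nn_integral_exp_avg) auto
  then have B_null: "AE z in zz_mu U. exp_avg (indicator B) z = 0"
    by (subst (asm) nn_integral_0_iff_AE) auto
  \<comment> \<open>The factor \<open>b\<close> is left free so that it can later be the value
    \<open>fn n z\<close>, which bounds the product
    \<open>fn n z * resolvent (fn n) z\<close>.\<close>
  have pointwise: "(\<lambda>n. resolvent (fn n) z) \<longlonglongrightarrow> resolvent f z \<and>
      (\<forall>n b. \<bar>b * resolvent (fn n) z\<bar> \<le> (b\<^sup>2 + enn2real (H z)) / (2 * l))"
    if z: "z \<in> zz_E" and Hz: "H z \<noteq> \<infinity>" and Bz: "exp_avg (indicator B) z = 0" for z
  proof -
    let ?e = "\<lambda>t. indicator {0..} t * exp (- l * t)"
    let ?K = "\<lambda>t. K (max 0 t) z"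
    let ?rho = "\<lambda>t. \<integral>\<^sup>+w. ennreal ((h w)\<^sup>2) \<partial>?K t"
    let ?r = "\<lambda>t. enn2real (?rho t)"
    have rho_meas [measurable]: "?rho \<in> borel_measurable borel"
      by (rule nn_semigroup_section_measurable) (use z in auto)
    have ind_meas [measurable]: "(\<lambda>t. \<integral>\<^sup>+w. indicator B w \<partial>?K t) \<in> borel_measurable borel"
      by (rule nn_semigroup_section_measurable) (use z in auto)
    have P_meas [measurable]: "(\<lambda>t. zz_semigroup K (max 0 t) (fn n) z) \<in> borel_measurable borel"
      "(\<lambda>t. zz_semigroup K (max 0 t) f z) \<in> borel_measurable borel" for n
      using z by measurable
    have H_eq: "H z = (\<integral>\<^sup>+t. ennreal (indicator {0..} t * (l * exp (- l * t))) * ?rho t \<partial>lborel)"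
      by (simp add: H_def exp_avg_def)
    \<comment> \<open>The exponential weight is positive for all \<open>t \<ge> 0\<close>, so
      finiteness of \<open>H z\<close>, and below the vanishing on \<open>B\<close>, pass to almost
      every such \<open>t\<close>.\<close>
    have "AE t in lborel. ennreal (indicator {0..} t * (l * exp (- l * t))) * ?rho t \<noteq> \<infinity>"
      using Hz unfolding H_eq by (intro nn_integral_noteq_infinite) auto
    then have rho_fin: "AE t in lborel. 0 \<le> t \<longrightarrow> ?rho t < \<infinity>"
      by eventually_elim (use l_pos in \<open>auto simp: ennreal_mult_eq_top_iff less_top\<close>)
    have "AE t in lborel. ennreal (indicator {0..} t * (l * exp (- l * t))) * (\<integral>\<^sup>+w. indicator B w \<partial>?K t) = 0"
      using Bz unfolding exp_avg_def by (subst (asm) nn_integral_0_iff_AE) auto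
    then have B_zero: "AE t in lborel. 0 \<le> t \<longrightarrow> (\<integral>\<^sup>+w. indicator B w \<partial>?K t) = 0"
      by eventually_elim (use l_pos in \<open>auto simp: ennreal_eq_0_iff mult_le_0_iff\<close>)
    have r_int: "integrable lborel (\<lambda>t. ?e t * ?r t)"
      and r_eq: "l * (\<integral>t. ?e t * ?r t \<partial>lborel) = enn2real (H z)"
    proof -
      have "(\<integral>\<^sup>+t. ennreal (l * (?e t * ?r t)) \<partial>lborel) = H z"
        unfolding H_eq
      proof (rule nn_integral_cong_AE, use rho_fin in eventually_elim)
        fix t assume "0 \<le> t \<longrightarrow> ?rho t < \<infinity>"
        then show "ennreal (l * (?e t * ?r t)) = ennreal (indicator {0..} t * (l * exp (- l * t))) * ?rho t"
          using l_pos by (cases "0 \<le> t") (auto simp: ennreal_mult mult.assoc[symmetric])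
      qed
      then have "(\<integral>\<^sup>+t. ennreal (l * (?e t * ?r t)) \<partial>lborel) = ennreal (enn2real (H z))"
        using Hz by (simp add: less_top)
      then have "has_bochner_integral lborel (\<lambda>t. l * (?e t * ?r t)) (enn2real (H z))"
        by (intro has_bochner_integral_nn_integral) (use l_pos in auto)
      then show "integrable lborel (\<lambda>t. ?e t * ?r t)" "l * (\<integral>t. ?e t * ?r t \<partial>lborel) = enn2real (H z)"
        using l_pos by (auto simp: has_bochner_integral_iff)
    qed
    \<comment> \<open>At such a time, dominated convergence applies under \<open>K t z\<close> with
      majorant \<open>h\<close>, which is integrable because
      \<open>h \<le> 1 + h * h\<close>.\<close>
    have good: "\<bar>b * zz_semigroup K t (fn n) z\<bar> \<le> (b\<^sup>2 + ?r t) / 2 \<and>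
        (\<lambda>n. zz_semigroup K t (fn n) z) \<longlonglongrightarrow> zz_semigroup K t f z"
      if t: "0 \<le> t" and fin: "?rho t < \<infinity>" and B0: "(\<integral>\<^sup>+w. indicator B w \<partial>?K t) = 0" for t b n
    proof -
      have t': "max 0 t = t" using t by simp
      interpret Kt: prob_space "K t z" by (rule K_prob_space[OF t z])
      note [measurable_cong] = K_prob_space(2)[OF t z]
      have h2_int: "integrable (K t z) (\<lambda>w. (h w)\<^sup>2)"
        using fin by (auto simp: integrable_iff_bounded t')
      have r_eq: "(\<integral>w. (h w)\<^sup>2 \<partial>K t z) = ?r t"
        by (subst integral_eq_nn_integral) (auto simp: t')
      have h_nonneg: "0 \<le> h w" for w
        using le[of 0 w] by linarith
      have h_int: "integrable (K t z) h"
      proof (rule Bochner_Integration.integrable_bound)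
        show "integrable (K t z) (\<lambda>w. 1 + (h w)\<^sup>2)" using h2_int by simp
        show "AE w in K t z. norm (h w) \<le> norm (1 + (h w)\<^sup>2)"
        proof (intro AE_I2)
          fix w
          have "0 \<le> (h w - 1)\<^sup>2" by simp
          then show "norm (h w) \<le> norm (1 + (h w)\<^sup>2)"
            using h_nonneg[of w] by (simp add: power2_eq_square algebra_simps)
        qed
      qed simp
      have fn_int: "integrable (K t z) (fn n)" for n
        by (rule Bochner_Integration.integrable_bound[OF h_int]) (use le h_nonneg in auto)
      have "\<bar>b * zz_semigroup K t (fn n) z\<bar> = \<bar>\<integral>w. b * fn n w \<partial>K t z\<bar>"
        by (simp add: zz_semigroup_def)
      also have "\<dots> \<le> (\<integral>w. \<bar>b * fn n w\<bar> \<partial>K t z)"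
        by (rule integral_abs_bound)
      also have "\<dots> \<le> (\<integral>w. (b\<^sup>2 + (h w)\<^sup>2) / 2 \<partial>K t z)"
      proof (rule integral_mono)
        fix w
        have "\<bar>b * fn n w\<bar> \<le> \<bar>b\<bar> * h w"
          using le[of n w] by (simp add: abs_mult mult_left_mono)
        also have "\<dots> \<le> (b\<^sup>2 + (h w)\<^sup>2) / 2"
          using sum_squares_bound[of "\<bar>b\<bar>" "h w"] by simp
        finally show "\<bar>b * fn n w\<bar> \<le> (b\<^sup>2 + (h w)\<^sup>2) / 2" .
      qed (use fn_int h2_int in auto)
      also have "\<dots> = (b\<^sup>2 + ?r t) / 2"
        using h2_int r_eq by (simp add: Kt.prob_space)
      finally have bd: "\<bar>b * zz_semigroup K t (fn n) z\<bar> \<le> (b\<^sup>2 + ?r t) / 2" .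
      have "AE w in K t z. w \<notin> B"
        using B0 unfolding t' by (subst (asm) nn_integral_0_iff_AE) (auto simp: indicator_eq_0_iff)
      then have "AE w in K t z. (\<lambda>n. fn n w) \<longlonglongrightarrow> f w"
        using AE_space by eventually_elim (auto simp: B_def K_prob_space(3)[OF t z] space_zz_M)
      then have "(\<lambda>n. zz_semigroup K t (fn n) z) \<longlonglongrightarrow> zz_semigroup K t f z"
        unfolding zz_semigroup_def
        by (intro integral_dominated_convergence[where w = h] h_int) (use le in auto)
      with bd show ?thesis by blast
    qed
    have e_int: "integrable lborel ?e" "(\<integral>t. ?e t \<partial>lborel) = 1 / l"
      using has_bochner_integral_exp_atLeast[OF l_pos] by (auto simp: has_bochner_integral_iff)
    have dom_int: "integrable lborel (\<lambda>t. (b\<^sup>2 * ?e t + ?e t * ?r t) / 2)" for b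
      using e_int r_int by simp
    have dom: "AE t in lborel. \<bar>b * (?e t * zz_semigroup K (max 0 t) (fn n) z)\<bar> \<le> (b\<^sup>2 * ?e t + ?e t * ?r t) / 2" for b n
      using rho_fin B_zero
    proof eventually_elim
      fix t assume *: "0 \<le> t \<longrightarrow> ?rho t < \<infinity>" "0 \<le> t \<longrightarrow> (\<integral>\<^sup>+w. indicator B w \<partial>?K t) = 0"
      show "\<bar>b * (?e t * zz_semigroup K (max 0 t) (fn n) z)\<bar> \<le> (b\<^sup>2 * ?e t + ?e t * ?r t) / 2"
      proof (cases "0 \<le> t")
        case True
        then have "?e t * \<bar>b * zz_semigroup K t (fn n) z\<bar> \<le> ?e t * ((b\<^sup>2 + ?r t) / 2)"
          using good[of t b n] * by (intro mult_left_mono) auto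
        then show ?thesis
          using True by (simp add: abs_mult algebra_simps add_divide_distrib)
      qed simp
    qed
    have "(\<lambda>n. resolvent (fn n) z) \<longlonglongrightarrow> resolvent f z"
      unfolding resolvent_eq_max
    proof (rule integral_dominated_convergence[OF _ _ dom_int[of 1]])
      show "AE t in lborel. norm (?e t * zz_semigroup K (max 0 t) (fn n) z) \<le> (1\<^sup>2 * ?e t + ?e t * ?r t) / 2" for n
        using dom[of 1 n] by simp
      show "AE t in lborel. (\<lambda>n. ?e t * zz_semigroup K (max 0 t) (fn n) z) \<longlonglongrightarrow> ?e t * zz_semigroup K (max 0 t) f z"
        using rho_fin B_zero
      proof eventually_elim
        fix t assume *: "0 \<le> t \<longrightarrow> ?rho t < \<infinity>" "0 \<le> t \<longrightarrow> (\<integral>\<^sup>+w. indicator B w \<partial>?K t) = 0"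
        show "(\<lambda>n. ?e t * zz_semigroup K (max 0 t) (fn n) z) \<longlonglongrightarrow> ?e t * zz_semigroup K (max 0 t) f z"
        proof (cases "0 \<le> t")
          case True
          then have "(\<lambda>n. zz_semigroup K t (fn n) z) \<longlonglongrightarrow> zz_semigroup K t f z"
            using good[of t] * by blast
          with True show ?thesis by (auto intro!: tendsto_intros simp: max_absorb2)
        qed simp
      qed
    qed simp_all
    moreover have "\<bar>b * resolvent (fn n) z\<bar> \<le> (b\<^sup>2 + enn2real (H z)) / (2 * l)" for n b
    proof -
      have "\<bar>b * resolvent (fn n) z\<bar> = norm (\<integral>t. b * (?e t * zz_semigroup K (max 0 t) (fn n) z) \<partial>lborel)"
        unfolding resolvent_eq_max by simp
      also have "\<dots> \<le> (\<integral>t. (b\<^sup>2 * ?e t + ?e t * ?r t) / 2 \<partial>lborel)"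
        by (rule order_trans[OF integral_norm_bound], rule integral_mono_AE')
           (use dom_int dom[of b n] in \<open>auto intro!: divide_nonneg_nonneg add_nonneg_nonneg mult_nonneg_nonneg\<close>)
      also have "\<dots> = (b\<^sup>2 * (1 / l) + (\<integral>t. ?e t * ?r t \<partial>lborel)) / 2"
        using e_int r_int by simp
      also have "\<dots> = (b\<^sup>2 + enn2real (H z)) / (2 * l)"
        using r_eq l_pos by (simp add: field_simps)
      finally show ?thesis .
    qed
    ultimately show ?thesis by blast
  qed
  have ev: "AE z in zz_mu U. (\<lambda>n. resolvent (fn n) z) \<longlonglongrightarrow> resolvent f z \<and>
      (\<forall>n b. \<bar>b * resolvent (fn n) z\<bar> \<le> (b\<^sup>2 + enn2real (H z)) / (2 * l))"
    using H_fin B_null AE_space by eventually_elim (rule pointwise, auto simp: space_zz_mu)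
  have R_meas [measurable]: "resolvent (fn n) \<in> borel_measurable zz_M" "resolvent f \<in> borel_measurable zz_M" for n
    by (simp_all add: resolvent_measurable)
  have "integrable (zz_mu U) (\<lambda>z. enn2real (H z))"
    unfolding integrable_iff_bounded
    using H_int by (auto intro: order_le_less_trans[OF nn_integral_mono] simp: ennreal_enn2real_if)
  then have dom_int: "integrable (zz_mu U) (\<lambda>z. ((h z)\<^sup>2 + enn2real (H z)) / (2 * l))"
    using h2 by simp
  have "(\<lambda>n. \<integral>z. fn n z * resolvent (fn n) z \<partial>zz_mu U) \<longlonglongrightarrow> (\<integral>z. f z * resolvent f z \<partial>zz_mu U)"
  proof (rule integral_dominated_convergence[OF _ _ dom_int])
    show "AE z in zz_mu U. (\<lambda>n. fn n z * resolvent (fn n) z) \<longlonglongrightarrow> f z * resolvent f z"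
      using ev lim by eventually_elim (auto intro: tendsto_mult)
    show "AE z in zz_mu U. norm (fn n z * resolvent (fn n) z) \<le> ((h z)\<^sup>2 + enn2real (H z)) / (2 * l)" for n
      using ev
    proof eventually_elim
      case (elim z)
      \<comment> \<open>This is the pointwise bound at \<open>b = fn n z\<close>.\<close>
      have "\<bar>fn n z * resolvent (fn n) z\<bar> \<le> ((fn n z)\<^sup>2 + enn2real (H z)) / (2 * l)"
        using elim by blast
      also have "\<dots> \<le> ((h z)\<^sup>2 + enn2real (H z)) / (2 * l)"
        using power_mono[OF le[of n z], of 2] l_pos by (intro divide_right_mono) auto
      finally show ?case by simp
    qed
  qed simp_all
  then show ?thesis
    unfolding zz_var_eq_resolvent by (intro tendsto_intros)
qed

end

section \<open>The mixed Dirichlet identity and comparison for continuous observables\<close>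

context zz_target
begin

text \<open>The derivative of \<open>exp (- U x) * (\<beta> x * a x)\<close> loses its
  \<open>U'\<close> terms and integrates to 0. The pairs \<open>(a, b)\<close> and
  \<open>(\<alpha>, \<beta>)\<close> may stem from different processes: the equation for
  \<open>\<beta>\<close> does not see the rate, so only the \<open>\<kappa>\<close> of the first
  pair appears.\<close>

lemma dirichlet_identity:
  fixes a b \<alpha> \<beta> g \<kappa> :: "real \<Rightarrow> real"
  assumes a: "\<And>x. (a has_real_derivative \<kappa> x * b x) (at x)"
    and \<beta>: "\<And>x. (\<beta> has_real_derivative U' x * \<beta> x + l * \<alpha> x - g x) (at x)"
    and cont: "continuous_on UNIV a" "continuous_on UNIV b" "continuous_on UNIV \<alpha>" "continuous_on UNIV \<beta>"
      "continuous_on UNIV g" "continuous_on UNIV \<kappa>"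
    and bd: "\<And>x. \<bar>a x\<bar> \<le> M" "\<And>x. \<bar>b x\<bar> \<le> M" "\<And>x. \<bar>\<alpha> x\<bar> \<le> M" "\<And>x. \<bar>\<beta> x\<bar> \<le> M" "\<And>x. \<bar>g x\<bar> \<le> M"
    and \<kappa>: "\<And>x. 0 \<le> \<kappa> x" "\<And>x. \<kappa> x \<le> c + C * \<bar>U' x\<bar>"
  shows "integrable lborel (\<lambda>x. exp (- U x) * (l * (a x * \<alpha> x) + \<kappa> x * (b x * \<beta> x)))"
    and "(\<integral>x. exp (- U x) * (g x * a x) \<partial>lborel)
       = (\<integral>x. exp (- U x) * (l * (a x * \<alpha> x) + \<kappa> x * (b x * \<beta> x)) \<partial>lborel)"
proof -
  note [measurable] = cont[THEN borel_measurable_continuous_onI]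
  have M: "0 \<le> M" using bd(1)[of 0] by linarith
  have prod: "\<bar>p * q\<bar> \<le> M * M" if "\<bar>p\<bar> \<le> M" "\<bar>q\<bar> \<le> M" for p q :: real
    using that M by (simp add: abs_mult mult_mono)
  have F_int: "integrable lborel (\<lambda>x. exp (- U x) * (\<beta> x * a x))"
    and ga_int: "integrable lborel (\<lambda>x. exp (- U x) * (g x * a x))"
    by (rule exp_mult_integrable[where a = "M * M" and b = 0]; use prod bd in simp)+
  show rhs_int: "integrable lborel (\<lambda>x. exp (- U x) * (l * (a x * \<alpha> x) + \<kappa> x * (b x * \<beta> x)))"
  proof (rule exp_mult_integrable)
    fix x
    have "\<bar>l * (a x * \<alpha> x) + \<kappa> x * (b x * \<beta> x)\<bar> \<le> \<bar>l\<bar> * \<bar>a x * \<alpha> x\<bar> + \<kappa> x * \<bar>b x * \<beta> x\<bar>"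
      using abs_triangle_ineq[of "l * (a x * \<alpha> x)" "\<kappa> x * (b x * \<beta> x)"] \<kappa>(1)[of x] by (simp add: abs_mult)
    also have "\<dots> \<le> \<bar>l\<bar> * (M * M) + \<kappa> x * (M * M)"
      by (intro add_mono mult_left_mono prod bd \<kappa>) simp
    also have "\<dots> \<le> \<bar>l\<bar> * (M * M) + (c + C * \<bar>U' x\<bar>) * (M * M)"
      using M by (intro add_left_mono mult_right_mono \<kappa>) simp
    also have "\<dots> = (\<bar>l\<bar> * (M * M) + c * (M * M)) + (C * (M * M)) * \<bar>U' x\<bar>"
      by (simp add: algebra_simps)
    finally show "\<bar>l * (a x * \<alpha> x) + \<kappa> x * (b x * \<beta> x)\<bar> \<le> \<dots>" .
  qed simp
  have "(\<integral>x. exp (- U x) * (l * (a x * \<alpha> x) + \<kappa> x * (b x * \<beta> x)) - exp (- U x) * (g x * a x) \<partial>lborel) = 0"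
  proof (rule integral_deriv_eq_0)
    show "((\<lambda>x. exp (- U x) * (\<beta> x * a x)) has_real_derivative
        exp (- U x) * (l * (a x * \<alpha> x) + \<kappa> x * (b x * \<beta> x)) - exp (- U x) * (g x * a x)) (at x)" for x
      by (rule derivative_eq_intros U_deriv a \<beta> refl)+ (simp add: algebra_simps)
    show "continuous_on UNIV (\<lambda>x. exp (- U x) * (l * (a x * \<alpha> x) + \<kappa> x * (b x * \<beta> x)) - exp (- U x) * (g x * a x))"
      by (intro continuous_intros cont U_cont)
  qed (use F_int ga_int rhs_int in auto)
  then show "(\<integral>x. exp (- U x) * (g x * a x) \<partial>lborel)
       = (\<integral>x. exp (- U x) * (l * (a x * \<alpha> x) + \<kappa> x * (b x * \<beta> x)) \<partial>lborel)"
    using ga_int rhs_int by simp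
qed

end

text \<open>The observable ignores the velocity, so only the even part of its resolvent
  contributes.\<close>

lemma (in zigzag_stationary) zz_var_even:
  assumes g: "continuous_on UNIV g" "\<And>x. \<bar>g x\<bar> \<le> M"
  shows "zz_var (zz_mu U) K l (\<lambda>z. g (fst z))
     = 2 / Z * (\<integral>x. exp (- U x) * (g x * even_part (\<lambda>z. g (fst z)) x) \<partial>lborel)"
proof -
  let ?f = "\<lambda>z :: real \<times> real. g (fst z)"
  have [measurable]: "g \<in> borel_measurable borel"
    using g(1) by (rule borel_measurable_continuous_onI)
  have f: "?f \<in> borel_measurable zz_M"
    by (rule borel_measurable_zz_M_I) simp
  have f_le: "\<bar>?f z\<bar> \<le> M" for z using g(2) by simp
  have r_meas [measurable]: "(\<lambda>x. resolvent ?f (x, v)) \<in> borel_measurable borel" if "v \<in> {-1, 1}" for v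
    by (rule resolvent_section_measurable[OF f that])
  have int: "integrable lborel (\<lambda>x. exp (- U x) * (g (fst (x, v)) * resolvent ?f (x, v)))" if v: "v \<in> {-1, 1}" for v
  proof (rule exp_mult_integrable[where a = "M * (M / l)" and b = 0])
    have M: "0 \<le> M" using g(2)[of 0] by linarith
    have "\<bar>resolvent ?f (x, v)\<bar> \<le> M / l" for x
      using resolvent_bound[OF f f_le, of "(x, v)"] v by (simp add: zz_E_def)
    then show "\<bar>g (fst (x, v)) * resolvent ?f (x, v)\<bar> \<le> M * (M / l) + 0 * \<bar>U' x\<bar>" for x
      using g(2)[of x] M l_pos unfolding abs_mult fst_conv
      by (simp only: mult_zero_left add_0_right) (intro mult_mono; simp)
  qed (use v in simp)
  have "(\<integral>z. ?f z * resolvent ?f z \<partial>zz_mu U) = (\<integral>x. exp (- U x) *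
      ((g (fst (x, 1 :: real)) * resolvent ?f (x, 1) + g (fst (x, -1 :: real)) * resolvent ?f (x, -1)) / 2) \<partial>lborel) / Z"
    by (rule integral_zz_mu(2)) (use int in auto)
  also have "\<dots> = (\<integral>x. exp (- U x) * (g x * even_part ?f x) \<partial>lborel) / Z"
    unfolding even_part_def by (simp add: distrib_left[of "g _"])
  finally show ?thesis
    unfolding zz_var_eq_resolvent by simp
qed

lemma zz_var_continuous_mono:
  assumes S1: "zigzag_stationary lam1 lbar l K1 U U' c1 C1"
    and S2: "zigzag_stationary lam2 lbar l K2 U U' c2 C2"
    and le: "\<And>x v. v \<in> {-1, 1} \<Longrightarrow> lam1 (x, v) \<le> lam2 (x, v)"
    and g: "continuous_on UNIV g" "\<And>x. \<bar>g x\<bar> \<le> M"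
  shows "zz_var (zz_mu U) K1 l (\<lambda>z. g (fst z)) \<le> zz_var (zz_mu U) K2 l (\<lambda>z. g (fst z))"
proof -
  interpret P1: zigzag_stationary lam1 lbar l K1 U U' c1 C1 by fact
  interpret P2: zigzag_stationary lam2 lbar l K2 U U' c2 C2 by fact
  let ?f = "\<lambda>z :: real \<times> real. g (fst z)"
  have g_meas: "g \<in> borel_measurable borel"
    using g(1) by (rule borel_measurable_continuous_onI)
  have f: "?f \<in> borel_measurable zz_M"
    by (rule borel_measurable_zz_M_I) (simp add: g_meas)
  have f_le: "\<bar>?f z\<bar> \<le> M" for z using g(2) by simp
  have f_cont: "continuous_on UNIV (\<lambda>x. ?f (x, v))" for v
    using g(1) by simp
  \<comment> \<open>A common bound for \<open>g\<close>, which is at most \<open>M\<close>, and for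
    the even and odd parts, which are at most \<open>M / l\<close>.\<close>
  define N where "N = max M (M / l)"
  let ?a1 = "P1.even_part ?f" and ?b1 = "P1.odd_part ?f" and ?k1 = "P1.total_rate"
  let ?a2 = "P2.even_part ?f" and ?b2 = "P2.odd_part ?f" and ?k2 = "P2.total_rate"
  have a1: "(?a1 has_real_derivative ?k1 x * ?b1 x) (at x)"
    and a2: "(?a2 has_real_derivative ?k2 x * ?b2 x) (at x)"
    and b1: "(?b1 has_real_derivative U' x * ?b1 x + l * ?a1 x - g x) (at x)"
    and b2: "(?b2 has_real_derivative U' x * ?b2 x + l * ?a2 x - g x) (at x)" for x
    using P1.even_part_deriv[OF f f_le f_cont, of x] P2.even_part_deriv[OF f f_le f_cont, of x]
      P1.odd_part_deriv[OF f f_le f_cont, of x] P2.odd_part_deriv[OF f f_le f_cont, of x]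
    by (simp_all add: P1.lam_diff P2.lam_diff)
  note conts = P1.parts_cont[OF f f_le] P2.parts_cont[OF f f_le] P1.total_rate_cont P2.total_rate_cont g(1)
  have bds: "\<bar>?a1 x\<bar> \<le> N" "\<bar>?b1 x\<bar> \<le> N" "\<bar>?a2 x\<bar> \<le> N" "\<bar>?b2 x\<bar> \<le> N" "\<bar>g x\<bar> \<le> N" for x
    using P1.parts_bound[OF f f_le, of x] P2.parts_bound[OF f f_le, of x] g(2)[of x] by (auto simp: N_def)
  \<comment> \<open>In \<open>conts\<close>, 1 and 2 are the parts for the first process, 3 and 4
    those for the second, 5 and 6 the rates, 7 is \<open>g\<close>. The mixed identity
    \<open>id12\<close> pairs \<open>a1\<close> with \<open>b2\<close> and so carries the smaller
    rate.\<close>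
  note id11 = P1.dirichlet_identity[OF a1 b1 conts(1,2,1,2,7,5) bds(1,2,1,2,5) P1.total_rate_nonneg P1.total_rate_le]
  note id12 = P1.dirichlet_identity[OF a1 b2 conts(1,2,3,4,7,5) bds(1,2,3,4,5) P1.total_rate_nonneg P1.total_rate_le]
  note id22 = P1.dirichlet_identity[OF a2 b2 conts(3,4,3,4,7,6) bds(3,4,3,4,5) P2.total_rate_nonneg P2.total_rate_le]
  let ?X1 = "\<integral>x. exp (- U x) * (g x * ?a1 x) \<partial>lborel" and ?X2 = "\<integral>x. exp (- U x) * (g x * ?a2 x) \<partial>lborel"
  have "2 * ?X1 = (\<integral>x. 2 * (exp (- U x) * (l * (?a1 x * ?a2 x) + ?k1 x * (?b1 x * ?b2 x))) \<partial>lborel)"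
    using id12(2) by simp
  also have "\<dots> \<le> (\<integral>x. exp (- U x) * (l * (?a1 x * ?a1 x) + ?k1 x * (?b1 x * ?b1 x))
      + exp (- U x) * (l * (?a2 x * ?a2 x) + ?k2 x * (?b2 x * ?b2 x)) \<partial>lborel)"
  proof (rule integral_mono)
    fix x
    have k: "?k1 x \<le> ?k2 x"
      using le[of 1 x] le[of "-1" x] by (simp add: P1.total_rate_def P2.total_rate_def)
    have sq: "2 * (p * q) \<le> p * p + q * q" for p q :: real
      using sum_squares_bound[of p q] by (simp add: power2_eq_square)
    have "l * (2 * (?a1 x * ?a2 x)) \<le> l * (?a1 x * ?a1 x + ?a2 x * ?a2 x)"
      using P1.l_pos by (intro mult_left_mono sq) simp
    moreover have "?k1 x * (2 * (?b1 x * ?b2 x)) \<le> ?k1 x * (?b1 x * ?b1 x + ?b2 x * ?b2 x)"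
      by (intro mult_left_mono sq P1.total_rate_nonneg)
    \<comment> \<open>The ordering of the intensities enters here: the square of \<open>b2\<close>
      came with the first rate but belongs to the second process.\<close>
    moreover have "?k1 x * (?b2 x * ?b2 x) \<le> ?k2 x * (?b2 x * ?b2 x)"
      by (intro mult_right_mono k) simp
    ultimately have "2 * (l * (?a1 x * ?a2 x) + ?k1 x * (?b1 x * ?b2 x))
        \<le> (l * (?a1 x * ?a1 x) + ?k1 x * (?b1 x * ?b1 x)) + (l * (?a2 x * ?a2 x) + ?k2 x * (?b2 x * ?b2 x))"
      unfolding distrib_left by linarith
    from mult_left_mono[OF this, of "exp (- U x)"]
    show "2 * (exp (- U x) * (l * (?a1 x * ?a2 x) + ?k1 x * (?b1 x * ?b2 x)))
        \<le> exp (- U x) * (l * (?a1 x * ?a1 x) + ?k1 x * (?b1 x * ?b1 x))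
        + exp (- U x) * (l * (?a2 x * ?a2 x) + ?k2 x * (?b2 x * ?b2 x))"
      by (simp only: distrib_left mult.left_commute[of 2] exp_ge_zero)
  qed (use id11(1) id12(1) id22(1) in auto)
  also have "\<dots> = ?X1 + ?X2"
    using id11 id22 by simp
  finally have "?X1 \<le> ?X2" by simp
  then show ?thesis
    unfolding P1.zz_var_even[OF g] P2.zz_var_even[OF g] using P1.Z_pos
    by (intro mult_left_mono) auto
qed

section \<open>Approximation of square-integrable observables\<close>

lemma (in zz_target) AE_zz_mu_fst:
  assumes "N \<in> null_sets lborel"
  shows "AE z in zz_mu U. fst z \<notin> N"
proof -
  have [measurable]: "N \<in> sets borel" using assms by auto
  have m: "(\<lambda>z. indicator N (fst z) :: ennreal) \<in> borel_measurable zz_M"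
    by (rule borel_measurable_zz_M_I) simp
  have "(\<integral>\<^sup>+z. indicator N (fst z) \<partial>zz_M) = 0"
    using assms by (subst nn_integral_zz_M[OF m]) auto
  then have "AE z in zz_M. (indicator N (fst z) :: ennreal) = 0"
    by (subst (asm) nn_integral_0_iff_AE[OF m])
  then have "AE z in zz_M. fst z \<notin> N"
    by eventually_elim (auto simp: indicator_def split: if_splits)
  then show ?thesis
    unfolding zz_mu_eq by (subst AE_density) (auto elim: eventually_mono)
qed

text \<open>By symmetry \<open>f\<close> is almost everywhere a function of the position alone,
  hence an almost everywhere limit of continuous functions of the position; both variances pass to
  the limit.\<close>

lemma zz_var_bounded_mono:
  assumes S1: "zigzag_stationary lam1 lbar l K1 U U' c1 C1"
    and S2: "zigzag_stationary lam2 lbar l K2 U U' c2 C2"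
    and le: "\<And>x v. v \<in> {-1, 1} \<Longrightarrow> lam1 (x, v) \<le> lam2 (x, v)"
    and f: "f \<in> borel_measurable zz_M" "\<And>z. \<bar>f z\<bar> \<le> M"
    and f_sym: "AE z in zz_mu U. f (fst z, - snd z) = f z"
  shows "zz_var (zz_mu U) K1 l f \<le> zz_var (zz_mu U) K2 l f"
proof -
  interpret P1: zigzag_stationary lam1 lbar l K1 U U' c1 C1 by fact
  interpret P2: zigzag_stationary lam2 lbar l K2 U U' c2 C2 by fact
  have M: "0 \<le> M" using f(2)[of "(0, 0)"] by linarith
  have "(\<lambda>x. f (x, 1)) \<in> borel_measurable borel"
    using measurable_compose[OF measurable_zz_M_Pair f(1)] by simp
  then have "(\<lambda>x. f (x, 1)) \<in> borel_measurable (lebesgue_on UNIV)"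
    by (simp add: lebesgue_on_UNIV_eq measurable_completion)
  then have "(\<lambda>x. f (x, 1)) measurable_on UNIV"
    by (subst measurable_on_iff_borel_measurable) auto
  then obtain N gn where N: "negligible N" and gn: "\<And>n. continuous_on UNIV (gn n)"
      and lim: "\<And>x. x \<notin> N \<Longrightarrow> (\<lambda>n. gn n x) \<longlonglongrightarrow> f (x, 1)"
    by (auto simp: measurable_on_def)
  \<comment> \<open>The exceptional set is only Lebesgue null; a Borel null set covering it is
    needed for the target measure.\<close>
  obtain N' where N': "N' \<in> null_sets lborel" "N \<subseteq> N'"
    using N by (auto simp: negligible_iff_null_sets null_sets_completion_iff2)
  \<comment> \<open>Clamping to \<open>[- M, M]\<close> gives a uniform bound and keeps the limit,
    as \<open>f\<close> takes its values there.\<close>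
  define g where "g n x = max (- M) (min M (gn n x))" for n :: nat and x :: real
  have g_cont: "continuous_on UNIV (g n)" for n
    unfolding g_def by (intro continuous_intros gn)
  have g_le: "\<bar>g n x\<bar> \<le> M" for n x
    using M by (auto simp: g_def)
  have g_meas: "(\<lambda>z. g n (fst z)) \<in> borel_measurable zz_M" for n
    by (rule borel_measurable_zz_M_I) (simp add: borel_measurable_continuous_onI[OF g_cont])
  have conv: "AE z in zz_mu U. (\<lambda>n. g n (fst z)) \<longlonglongrightarrow> f z"
    using P1.AE_zz_mu_fst[OF N'(1)] f_sym AE_space
  proof eventually_elim
    case (elim z)
    then have "snd z = 1 \<or> snd z = -1"
      by (auto simp: P1.space_zz_mu zz_E_def)
    then have fz: "f (fst z, 1) = f z"
      using elim(2) by (cases z) auto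
    have "(\<lambda>n. gn n (fst z)) \<longlonglongrightarrow> f z"
      using lim[of "fst z"] elim(1) N'(2) fz by auto
    then have "(\<lambda>n. g n (fst z)) \<longlonglongrightarrow> max (- M) (min M (f z))"
      unfolding g_def by (intro tendsto_intros)
    moreover have "max (- M) (min M (f z)) = f z"
      using f(2)[of z] by auto
    ultimately show ?case by simp
  qed
  have "integrable (zz_mu U) (\<lambda>z. M\<^sup>2)"
    using P1.prob_space_zz_mu by (simp add: prob_space_def finite_measure.integrable_const)
  note var_lims = P1.zz_var_tendsto[OF g_meas f(1) _ g_le this conv] P2.zz_var_tendsto[OF g_meas f(1) _ g_le this conv]
  show ?thesis
    by (rule LIMSEQ_le[OF var_lims])
       (auto intro!: zz_var_continuous_mono[OF S1 S2 le g_cont g_le])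
qed

text \<open>Truncation at level \<open>n\<close> preserves the symmetry and is dominated by
  \<open>\<bar>f\<bar>\<close>, whose square is integrable.\<close>

lemma zz_var_mono:
  assumes S1: "zigzag_stationary lam1 lbar l K1 U U' c1 C1"
    and S2: "zigzag_stationary lam2 lbar l K2 U U' c2 C2"
    and le: "\<And>x v. v \<in> {-1, 1} \<Longrightarrow> lam1 (x, v) \<le> lam2 (x, v)"
    and f: "zz_L2 (zz_mu U) f"
    and f_sym: "AE z in zz_mu U. f (fst z, - snd z) = f z"
  shows "zz_var (zz_mu U) K1 l f \<le> zz_var (zz_mu U) K2 l f"
proof -
  interpret P1: zigzag_stationary lam1 lbar l K1 U U' c1 C1 by fact
  interpret P2: zigzag_stationary lam2 lbar l K2 U U' c2 C2 by fact
  have f_meas [measurable]: "f \<in> borel_measurable zz_M" and f_int: "integrable (zz_mu U) (\<lambda>z. \<bar>f z\<bar>\<^sup>2)"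
    using f by (auto simp: zz_L2_def cong: measurable_cong_sets)
  define g where "g n z = max (- real n) (min (real n) (f z))" for n z
  have g_meas: "g n \<in> borel_measurable zz_M" for n
    unfolding g_def by measurable
  have g_le: "\<bar>g n z\<bar> \<le> real n" "\<bar>g n z\<bar> \<le> \<bar>f z\<bar>" for n z
    by (auto simp: g_def)
  have g_sym: "AE z in zz_mu U. g n (fst z, - snd z) = g n z" for n
    using f_sym by eventually_elim (simp add: g_def)
  have conv: "AE z in zz_mu U. (\<lambda>n. g n z) \<longlonglongrightarrow> f z"
  proof (intro AE_I2 tendsto_eventually)
    fix z
    obtain n0 where "\<bar>f z\<bar> < real n0" using reals_Archimedean2 by blast
    then have "g n z = f z" if "n0 \<le> n" for n
      using that by (auto simp: g_def)
    then show "\<forall>\<^sub>F n in sequentially. g n z = f z"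
      using eventually_sequentially by blast
  qed
  have abs_meas: "(\<lambda>z. \<bar>f z\<bar>) \<in> borel_measurable zz_M" by measurable
  show ?thesis
    by (rule LIMSEQ_le[OF P1.zz_var_tendsto[OF g_meas f_meas abs_meas g_le(2) f_int conv]
          P2.zz_var_tendsto[OF g_meas f_meas abs_meas g_le(2) f_int conv]])
       (auto intro!: zz_var_bounded_mono[OF S1 S2 le g_meas g_le(1) g_sym])
qed

theorem theorem5p18:
  fixes U U' U'' :: "real \<Rightarrow> real"
    and lbar c C l :: real
    and \<gamma> :: "real \<times> real \<Rightarrow> real"
    and K1 K2 :: "real \<Rightarrow> real \<times> real \<Rightarrow> (real \<times> real) measure"
    and f :: "real \<times> real \<Rightarrow> real"
  assumes U_deriv: "\<And>x. (U has_real_derivative U' x) (at x)"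
    and U'_deriv: "\<And>x. (U' has_real_derivative U'' x) (at x)"
    and U''_cont: "continuous_on UNIV U''"
    and U_int: "integrable lborel (\<lambda>x. (1 + \<bar>U' x\<bar>) * exp (- U x))"
    and U'_sq_int: "integrable lborel (\<lambda>x. (U' x)\<^sup>2 * exp (- U x))"
    and lbar: "lbar \<ge> 0"
    and gamma_C1: "\<And>v. v \<in> {-1, 1} \<Longrightarrow> \<exists>g'. (\<forall>x. ((\<lambda>x. \<gamma> (x, v)) has_real_derivative g' x) (at x))
                                              \<and> continuous_on UNIV g'"
    and cC: "c > 0" "C > 0"
    and gamma_nonneg: "\<And>z. z \<in> zz_E \<Longrightarrow> 0 \<le> \<gamma> z"
    and gamma_bound: "\<And>x v. (x, v) \<in> zz_E \<Longrightarrow> \<gamma> (x, v) \<le> c + C * \<bar>U' x\<bar>"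
    and gamma_sym: "\<And>x v. (x, v) \<in> zz_E \<Longrightarrow> \<gamma> (x, v) = \<gamma> (x, - v)"
    and K1: "zz_kernel (\<lambda>(x, v). max 0 (U' x * v)) lbar K1"
    and K2: "zz_kernel (\<lambda>(x, v). max 0 (U' x * v) + \<gamma> (x, v)) lbar K2"
    and f_L2: "zz_L2 (zz_mu U) f"
    and f_sym: "AE z in zz_mu U. f (fst z, - snd z) = f z"
    and l_pos: "l > 0"
  shows "zz_var (zz_mu U) K1 l f \<le> zz_var (zz_mu U) K2 l f"
proof -
  have U'_cont: "continuous_on UNIV U'"
    using U'_deriv by (meson DERIV_isCont continuous_at_imp_continuous_on)
  have U_cont: "continuous_on UNIV U"
    using U_deriv by (meson DERIV_isCont continuous_at_imp_continuous_on)
  note [measurable] = borel_measurable_continuous_onI[OF U_cont] borel_measurable_continuous_onI[OF U'_cont]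
  have exp_int: "integrable lborel (\<lambda>x. exp (- U x))"
    by (rule Bochner_Integration.integrable_bound[OF U_int]) (auto simp: distrib_right)
  have U'_exp_int: "integrable lborel (\<lambda>x. \<bar>U' x\<bar> * exp (- U x))"
    by (rule Bochner_Integration.integrable_bound[OF U_int]) (auto simp: distrib_right)
  have \<gamma>_cont: "continuous_on UNIV (\<lambda>x. \<gamma> (x, v))" if "v \<in> {-1, 1}" for v
    using gamma_C1[OF that] by (meson DERIV_isCont continuous_at_imp_continuous_on)
  have \<gamma>_nonneg: "0 \<le> \<gamma> (x, v)" and \<gamma>_le: "\<gamma> (x, v) \<le> c + C * \<bar>U' x\<bar>"
    if "v \<in> {-1, 1}" for x v
    using gamma_nonneg[of "(x, v)"] gamma_bound[of x v] that by (auto simp: zz_E_def)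
  have \<gamma>_sym: "\<gamma> (x, 1) = \<gamma> (x, -1)" for x
    using gamma_sym[of x 1] by (simp add: zz_E_def)
  \<comment> \<open>The constants 0 and 1 express that the positive part of \<open>U' x * v\<close>
    is at most \<open>\<bar>U' x\<bar>\<close>; the balance condition is the difference of positive
    and negative part.\<close>
  have S1: "zigzag_stationary (\<lambda>(x, v). max 0 (U' x * v)) lbar l K1 U U' 0 1"
    using K1 lbar l_pos U_deriv U'_cont exp_int U'_exp_int
    by unfold_locales (auto intro!: continuous_intros)
  \<comment> \<open>The bounds of the two summands add up to \<open>c\<close> and
    \<open>1 + C\<close>, and the even \<open>\<gamma>\<close> cancels in the balance
    condition.\<close>
  have S2: "zigzag_stationary (\<lambda>(x, v). max 0 (U' x * v) + \<gamma> (x, v)) lbar l K2 U U' c (1 + C)"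
  proof unfold_locales
    fix x v :: real assume v: "v \<in> {-1, 1}"
    show "continuous_on UNIV (\<lambda>x. case (x, v) of (x, v) \<Rightarrow> max 0 (U' x * v) + \<gamma> (x, v))"
      using \<gamma>_cont[OF v] U'_cont by (auto intro!: continuous_intros)
    have "max 0 (U' x * v) \<le> \<bar>U' x\<bar>" using v by auto
    with \<gamma>_le[OF v, of x]
    show "(case (x, v) of (x, v) \<Rightarrow> max 0 (U' x * v) + \<gamma> (x, v)) \<le> c + (1 + C) * \<bar>U' x\<bar>"
      by (simp add: distrib_right)
  next
    fix z assume "z \<in> zz_E"
    then show "0 \<le> (case z of (x, v) \<Rightarrow> max 0 (U' x * v) + \<gamma> (x, v))"
      using gamma_nonneg[of z] by (cases z) auto
  qed (use K2 lbar l_pos U_deriv U'_cont exp_int U'_exp_int \<gamma>_sym in auto)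
  show ?thesis
    by (rule zz_var_mono[OF S1 S2 _ f_L2 f_sym]) (use \<gamma>_nonneg in auto)
qed

end
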